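(* Let $\epsilon\in(0,1)$ be a constant. For every nonempty text $T\in\Sigma^n$, there exists a data structure of size $\mathcal{O}(r(T)\log^{2+\epsilon}n)$ that, given any $b,e\in[0..n]$ with $b<e$, returns $\arg\min_{i\in(b..e]}\mathrm{LCP}_T[i]$ (the smallest minimizing index) in $\mathcal{O}\big(\tfrac{\log n}{\log\log n}\big)$ time.
   Context: Model: word RAM with word size $w\ge\log n$; sizes in words. Lexicographic order: a proper prefix is smaller, otherwise compare at first difference. $\mathrm{SA}_T$ lists suffix starting positions in increasing lexicographic order; $\mathrm{LCP}_T[1]=0$ and $\mathrm{LCP}_T[i]$ ($i\ge2$) is the length of the longest common prefix of the suffixes starting at $\mathrm{SA}_T[i]$ and $\mathrm{SA}_T[i-1]$. $\mathrm{BWT}_T[i]=T[\mathrm{SA}_T[i]-1]$ if $\mathrm{SA}_T[i]>1$ and $T[n]$ otherwise; $r(T)$ is the number of maximal equal-letter runs of $\mathrm{BWT}_T$. *)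

theory Defs
  imports Complex_Main "HOL-Library.Sublist" "HOL-Library.List_Lexorder"
begin

section \<open>Suffix array, LCP array and BWT\<close>

text \<open>
  Text positions and array indices are 1-based: the letter $T[i]$ is \<open>T ! (i - 1)\<close>, and the suffix
  starting at position \<open>i\<close> is \<open>drop (i - 1) T\<close>. Lists are ordered by \<open>List_Lexorder\<close>, in which a proper
  prefix is smaller.
\<close>

definition suffix_at :: "'a list \<Rightarrow> nat \<Rightarrow> 'a list" where
  "suffix_at T i = drop (i - 1) T"

definition SA :: "'a::linorder list \<Rightarrow> nat \<Rightarrow> nat" where
  "SA T i = sort_key (suffix_at T) [1..<length T + 1] ! (i - 1)"

definition LCP :: "'a::linorder list \<Rightarrow> nat \<Rightarrow> nat" where
  "LCP T i = (if i = 1 then 0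
     else length (longest_common_prefix (suffix_at T (SA T i)) (suffix_at T (SA T (i - 1)))))"

definition BWT :: "'a::linorder list \<Rightarrow> nat \<Rightarrow> 'a" where
  "BWT T i = (if SA T i > 1 then T ! (SA T i - 1 - 1) else T ! (length T - 1))"

definition equal_letter_run :: "nat \<Rightarrow> (nat \<Rightarrow> 'a) \<Rightarrow> nat \<Rightarrow> nat \<Rightarrow> bool" where
  "equal_letter_run n X i j \<longleftrightarrow> 1 \<le> i \<and> i \<le> j \<and> j \<le> n \<and> (\<forall>k\<in>{i..j}. X k = X i)"

definition maximal_runs :: "nat \<Rightarrow> (nat \<Rightarrow> 'a) \<Rightarrow> (nat \<times> nat) set" where
  "maximal_runs n X = {(i, j). equal_letter_run n X i j \<and>
     (\<forall>i' j'. equal_letter_run n X i' j' \<and> i' \<le> i \<and> j \<le> j' \<longrightarrow> i' = i \<and> j' = j)}"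

definition bwt_runs :: "'a::linorder list \<Rightarrow> nat" where
  "bwt_runs T = card (maximal_runs (length T) (BWT T))"

definition LCP_argmin :: "'a::linorder list \<Rightarrow> nat \<Rightarrow> nat \<Rightarrow> nat" where
  "LCP_argmin T b e = (LEAST i. i \<in> {b<..e} \<and> (\<forall>j\<in>{b<..e}. LCP T i \<le> LCP T j))"


section \<open>Word RAM\<close>

text \<open>
  A word of size \<open>w\<close> is a natural number below \<open>2 ^ w\<close>; all arithmetic is modulo \<open>2 ^ w\<close>, with
  the HOL convention for division by zero. Every instruction costs one time unit.

  A memory address is given by two registers, the high and the low word. Data structures may have more than
  \<open>n\<close> words (the number of BWT runs can be linear in \<open>n\<close>), so for a word size close to
  \<open>log n\<close> a single word would not suffice to address them. With the high word equal to 0 this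
  is the usual one-word addressing.
\<close>

datatype binop = ADD | SUB | MUL | DIV | MOD | AND | OR | XOR | SHL | SHR

fun eval_binop :: "nat \<Rightarrow> binop \<Rightarrow> nat \<Rightarrow> nat \<Rightarrow> nat" where
  "eval_binop w ADD x y = (x + y) mod 2 ^ w"
| "eval_binop w SUB x y = (x + 2 ^ w - y) mod 2 ^ w"
| "eval_binop w MUL x y = (x * y) mod 2 ^ w"
| "eval_binop w DIV x y = x div y"
| "eval_binop w MOD x y = x mod y"
| "eval_binop w AND x y = Bit_Operations.and x y"
| "eval_binop w OR x y = Bit_Operations.or x y"
| "eval_binop w XOR x y = Bit_Operations.xor x y"
| "eval_binop w SHL x y = (x * 2 ^ y) mod 2 ^ w"
| "eval_binop w SHR x y = x div 2 ^ y"

datatype instr =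
    Const nat nat             \<comment> \<open>\<open>Const d c\<close>: \<open>d := c\<close>\<close>
  | Move nat nat              \<comment> \<open>\<open>Move d x\<close>: \<open>d := x\<close>\<close>
  | Arith binop nat nat nat   \<comment> \<open>\<open>Arith f d x y\<close>: \<open>d := f x y\<close>\<close>
  | Load nat nat nat          \<comment> \<open>\<open>Load d h l\<close>: \<open>d := M[h, l]\<close>\<close>
  | Store nat nat nat         \<comment> \<open>\<open>Store h l x\<close>: \<open>M[h, l] := x\<close>\<close>
  | Jump nat
  | Jump_eq nat nat nat       \<comment> \<open>\<open>Jump_eq x y t\<close>: if \<open>x = y\<close> then go to instruction \<open>t\<close>\<close>
  | Jump_less nat nat nat     \<comment> \<open>\<open>Jump_less x y t\<close>: if \<open>x < y\<close> then go to instruction \<open>t\<close>\<close>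

type_synonym ram_program = "instr list"

record ram_state =
  pc :: nat
  regs :: "nat \<Rightarrow> nat"
  mem :: "nat \<Rightarrow> nat"

definition address :: "nat \<Rightarrow> ram_state \<Rightarrow> nat \<Rightarrow> nat \<Rightarrow> nat" where
  "address w s h l = regs s h * 2 ^ w + regs s l"

definition set_reg :: "nat \<Rightarrow> nat \<Rightarrow> ram_state \<Rightarrow> ram_state" where
  "set_reg d v s = s\<lparr>pc := pc s + 1, regs := (regs s)(d := v)\<rparr>"

fun exec_instr :: "nat \<Rightarrow> instr \<Rightarrow> ram_state \<Rightarrow> ram_state" where
  "exec_instr w (Const d c) s = set_reg d (c mod 2 ^ w) s"
| "exec_instr w (Move d x) s = set_reg d (regs s x) s"
| "exec_instr w (Arith f d x y) s = set_reg d (eval_binop w f (regs s x) (regs s y)) s"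
| "exec_instr w (Load d h l) s = set_reg d (mem s (address w s h l)) s"
| "exec_instr w (Store h l x) s =
     s\<lparr>pc := pc s + 1, mem := (mem s)(address w s h l := regs s x)\<rparr>"
| "exec_instr w (Jump t) s = s\<lparr>pc := t\<rparr>"
| "exec_instr w (Jump_eq x y t) s = s\<lparr>pc := (if regs s x = regs s y then t else pc s + 1)\<rparr>"
| "exec_instr w (Jump_less x y t) s = s\<lparr>pc := (if regs s x < regs s y then t else pc s + 1)\<rparr>"

text \<open>The machine halts by leaving the program text.\<close>

definition halted :: "ram_program \<Rightarrow> ram_state \<Rightarrow> bool" where
  "halted P s \<longleftrightarrow> length P \<le> pc s"

definition step :: "nat \<Rightarrow> ram_program \<Rightarrow> ram_state \<Rightarrow> ram_state" where
  "step w P s = (if halted P s then s else exec_instr w (P ! pc s) s)"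

text \<open>
  The two query arguments are passed in registers 0 and 1, the answer is returned in register 0; each
  is a number in \<open>[0..n]\<close> reduced to a word. For \<open>n < 2 ^ w\<close> the reduction is the identity. For
  \<open>n = 2 ^ w\<close> it maps only \<open>n\<close> to 0, which is unambiguous for numbers in \<open>[1..n]\<close> (the
  right endpoint and the answer) and does not affect numbers in \<open>[0..n-1]\<close> (the left endpoint).
\<close>

definition query_state :: "nat \<Rightarrow> nat \<Rightarrow> nat \<Rightarrow> (nat \<Rightarrow> nat) \<Rightarrow> ram_state" where
  "query_state w x y m =
     \<lparr>pc = 0, regs = (\<lambda>_. 0)(0 := x mod 2 ^ w, 1 := y mod 2 ^ w), mem = m\<rparr>"

definition holds_structure :: "nat list \<Rightarrow> (nat \<Rightarrow> nat) \<Rightarrow> bool" where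
  "holds_structure D m \<longleftrightarrow> (\<forall>a<length D. m a = D ! a)"

text \<open>
  The structure \<open>D\<close> occupies the first \<open>length D\<close> memory cells; the other cells are
  uninitialised working memory. A query must leave the structure intact.
\<close>

definition answers_query ::
    "nat \<Rightarrow> ram_program \<Rightarrow> nat list \<Rightarrow> real \<Rightarrow> nat \<Rightarrow> nat \<Rightarrow> nat \<Rightarrow> bool" where
  "answers_query w P D time x y ans \<longleftrightarrow>
     (\<forall>m. range m \<subseteq> {..<2 ^ w} \<and> holds_structure D m \<longrightarrow>
       (\<exists>k s. real k \<le> time \<and> s = (step w P ^^ k) (query_state w x y m) \<and>
          halted P s \<and> regs s 0 = ans mod 2 ^ w \<and> holds_structure D (mem s)))"


section \<open>Logarithms in asymptotic bounds\<close>

text \<open>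
  For \<open>n \<ge> 4\<close> this is the binary logarithm; the truncation keeps \<open>log n\<close> and
  \<open>log log n\<close> positive, so that the bounds read as $O(1)$ for the finitely many smaller \<open>n\<close>.
\<close>

definition lg :: "nat \<Rightarrow> real" where
  "lg n = log 2 (max 4 (real n))"

end

theory Submission
  imports Defs "HOL-Library.Product_Lexorder"
begin

text \<open>
  Inside a BWT run, LF maps neighbouring suffix-array positions to neighbouring positions and increases
  the LCP value by 1. Hence every interval of the LCP array is, up to an additive constant, a copy of an
  interval that contains a run boundary.

  Let $\tau = 2^t \approx \log^{\epsilon/2} n$. On the scale $\tau^a$ an interval is moved to its copy at a
  boundary \<open>p\<close>, whose surroundings consist of $O(\tau)$ aligned blocks of length $\tau^{a-1}$. The two ends of a
  query are followed down the scales until they lie in different blocks. From there on the query consists of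
  two one-sided ones, each with one end at a block edge. For every block edge and every scale, the
  interval of length $\tau^a$ at that edge has its own copy, and for each block around that copy the minimum
  between the block and the edge is stored; so one lookup per scale reduces a one-sided query to one
  inside a single block, which again starts at an edge. There are
  $O(r \tau H)$ edges, each with $H = O(\log n / \log\log n)$ scales and $O(\tau)$ entries per scale,
  which gives $O(r \tau^2 H^2)$ words and $O(H)$ time.
\<close>

section \<open>Copies of LCP intervals at run boundaries\<close>

text \<open>Minima are taken over pairs (LCP value, position) in lexicographic order. Passing to a
  copy adds one constant to the values and another to the positions, so it preserves this order: the
  leftmost minimum of a copy is the image of the leftmost minimum of the original, and ties need no
  separate treatment.

  Candidates found in different copies can only be compared in original coordinates. The query
  therefore carries one end both in the current copy and in the original array, together with the
  accumulated LCP increment; these three numbers determine the translation back.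

  The word size is only known to be at least log n. A length of 2 ^ \<open>w\<close>, shifts to the
  left and distances on either side of an edge all meet wraparound, so most arithmetic facts below
  say when a computation modulo the word size gives the intended number. For long words the
  structure fits into two-word addresses because its size is at most 2 ^ \<open>w\<close> times a
  quartic polynomial in \<open>w\<close>.\<close>

definition suf :: "'a::linorder list \<Rightarrow> nat \<Rightarrow> 'a list" where
  "suf T k = suffix_at T (SA T (Suc k))"

definition lcp0 :: "'a::linorder list \<Rightarrow> nat \<Rightarrow> nat" where
  "lcp0 T k = LCP T (Suc k)"

text \<open>
  The text has no sentinel, so the LF mapping breaks not only at run boundaries but also next to the suffix
  starting at position 1.
\<close>

definition breaks :: "'a::linorder list \<Rightarrow> nat set" where
  "breaks T = {k. k < length T \<and>
     (k = 0 \<or> BWT T (Suc k) \<noteq> BWT T k \<or> SA T (Suc k) = 1 \<or> SA T k = 1)}"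

section \<open>Ranks of suffixes\<close>

lemma inj_on_suffix_at: "inj_on (suffix_at T) {1..length T}"
proof (rule inj_onI)
  fix i j assume "i \<in> {1..length T}" "j \<in> {1..length T}" and e: "suffix_at T i = suffix_at T j"
  moreover have "length T - (i - 1) = length T - (j - 1)"
    using arg_cong[OF e, of length] by (simp add: suffix_at_def)
  ultimately show "i = j" unfolding atLeastAtMost_iff by linarith
qed

lemma bij_betw_SA: "bij_betw (\<lambda>k. SA T (Suc k)) {..<length T} {1..length T}"
proof -
  let ?xs = "sort_key (suffix_at T) [1..<length T + 1]"
  have "bij_betw ((!) ?xs) {..<length ?xs} (set ?xs)"
    by (rule bij_betw_nth) auto
  moreover have "length ?xs = length T" "set ?xs = {1..length T}" by (auto simp del: upt_Suc)
  ultimately show ?thesis by (simp add: SA_def del: upt_Suc)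
qed

lemma SA_in: "k < length T \<Longrightarrow> SA T (Suc k) \<in> {1..length T}"
  using bij_betw_SA[of T] by (auto simp: bij_betw_def)

lemma SA_surj: "i \<in> {1..length T} \<Longrightarrow> \<exists>k<length T. SA T (Suc k) = i"
  using bij_betw_SA[of T] unfolding bij_betw_def by (metis imageE lessThan_iff)

lemma SA_inj: "\<lbrakk>SA T (Suc k) = SA T (Suc j); k < length T; j < length T\<rbrakk> \<Longrightarrow> k = j"
  using bij_betw_SA[of T] by (auto simp: bij_betw_def inj_on_def)

lemma suf_strict_mono:
  assumes "k < j" "j < length T" shows "suf T k < suf T j"
proof -
  let ?xs = "sort_key (suffix_at T) [1..<length T + 1]"
  have "sorted (map (suffix_at T) ?xs)" by simp
  then have "map (suffix_at T) ?xs ! k \<le> map (suffix_at T) ?xs ! j"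
    using assms by (intro sorted_nth_mono) auto
  then have "suf T k \<le> suf T j" using assms by (simp add: suf_def SA_def)
  moreover have "suf T k \<noteq> suf T j"
    using inj_onD[OF inj_on_suffix_at, of T "SA T (Suc k)" "SA T (Suc j)"] SA_in[of k T] SA_in[of j T]
      SA_inj[of T k j] assms by (auto simp: suf_def)
  ultimately show ?thesis by simp
qed

lemma suf_less_iff: "\<lbrakk>k < length T; j < length T\<rbrakk> \<Longrightarrow> suf T k < suf T j \<longleftrightarrow> k < j"
  by (metis linorder_neqE_nat order_less_asym order_less_irrefl suf_strict_mono)

lemma suffix_at_pred:
  assumes "k < length T" "SA T (Suc k) \<noteq> 1"
  shows "suffix_at T (SA T (Suc k) - 1) = BWT T (Suc k) # suf T k"
proof -
  define a where "a = SA T (Suc k)"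
  have "1 < a" "a \<le> length T" using assms SA_in[of k T] by (auto simp: a_def)
  then have "drop (a - 2) T = T ! (a - 2) # drop (Suc (a - 2)) T"
    by (intro Cons_nth_drop_Suc[symmetric]) auto
  moreover have "Suc (a - 2) = a - 1" using \<open>1 < a\<close> by simp
  ultimately show ?thesis using \<open>1 < a\<close>
    by (simp add: suffix_at_def BWT_def suf_def numeral_2_eq_2 flip: a_def)
qed

text \<open>LF preserves the order of suffixes preceded by the same letter. A suffix strictly
  between the images of two neighbours would begin with that letter too, and deleting the letter
  would give a suffix strictly between the neighbours themselves.\<close>

lemma adjacent_predecessors:
  assumes k: "0 < k" "k < length T" "k \<notin> breaks T"
  shows "\<exists>j. 0 < j \<and> j < length T \<and> Suc (SA T (Suc j)) = SA T (Suc k) \<and>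
     Suc (SA T j) = SA T k \<and> lcp0 T j = Suc (lcp0 T k)"
proof -
  define k' where "k' = k - 1"
  have k': "Suc k' = k" "k' < length T" using k by (auto simp: k'_def)
  define c where "c = BWT T (Suc k)"
  have B: "BWT T (Suc k') = c" and ne: "SA T (Suc k) \<noteq> 1" "SA T (Suc k') \<noteq> 1"
    using k by (auto simp: breaks_def k' c_def)
  have gt: "1 < SA T (Suc k)" "1 < SA T (Suc k')"
    "SA T (Suc k) \<le> length T" "SA T (Suc k') \<le> length T"
    using ne SA_in[of k T] SA_in[of k' T] k k' by auto
  obtain j where j: "j < length T" "SA T (Suc j) = SA T (Suc k) - 1"
    using SA_surj[of "SA T (Suc k) - 1" T] gt by fastforce
  obtain i where i: "i < length T" "SA T (Suc i) = SA T (Suc k') - 1"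
    using SA_surj[of "SA T (Suc k') - 1" T] gt by fastforce
  have sj: "suf T j = c # suf T k"
    using suffix_at_pred[OF k(2) ne(1)] j by (simp add: suf_def c_def)
  have si: "suf T i = c # suf T k'"
    using suffix_at_pred[OF k'(2) ne(2)] i B by (simp add: suf_def)
  have "suf T k' < suf T k" using suf_strict_mono[of k' k T] k k' by auto
  then have "suf T i < suf T j" by (simp add: si sj)
  then have ij: "i < j" using suf_less_iff i j by blast
  have "j = Suc i"
  proof (rule ccontr)
    assume "j \<noteq> Suc i"
    then have m: "i < Suc i" "Suc i < j" "Suc i < length T" using ij j by auto
    let ?y = "suf T (Suc i)"
    have y: "c # suf T k' < ?y" "?y < c # suf T k"
      using suf_strict_mono[of i "Suc i" T] suf_strict_mono[of "Suc i" j T] m j si sj by auto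
    then obtain y' where y': "?y = c # y'" "suf T k' < y'" "y' < suf T k"
      by (cases ?y) auto
    define a where "a = SA T (Suc (Suc i))"
    have a: "a \<in> {1..length T}" using SA_in[of "Suc i" T] m by (simp add: a_def)
    have "drop (a - 1) T = c # y'" using y' by (simp add: suf_def suffix_at_def a_def)
    then have "drop a T = y'" using a
        drop_Suc[of "a - 1" T] tl_drop[of "a - 1" T] by simp
    \<comment> \<open>Only a nonempty remainder is one of the ranked suffixes; this one is nonempty
      because it exceeds \<open>suf T k'\<close>.\<close>
    moreover have "y' \<noteq> []" using y'(2) by auto
    ultimately have "Suc a \<in> {1..length T}" using a by auto
    then obtain l where l: "l < length T" "SA T (Suc l) = Suc a" using SA_surj by blast
    have "suf T l = y'" using l \<open>drop a T = y'\<close> by (simp add: suf_def suffix_at_def)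
    then have "k' < l" "l < k" using y' suf_less_iff[of k' T l] suf_less_iff[of l T k] l k k' by auto
    then show False using k' by simp
  qed
  moreover have "lcp0 T j = Suc (lcp0 T k)"
    using sj si \<open>j = Suc i\<close> k(1) unfolding k'(1)[symmetric] lcp0_def LCP_def suf_def by simp
  ultimately show ?thesis using i j gt k' by (intro exI[of _ j]) auto
qed

text \<open>The pointwise images line up: the image of \<open>v\<close> is both the last point of
  the image of \<open>{u..v}\<close> and the left neighbour of the image of \<open>Suc v\<close>,
  and injectivity of the suffix array identifies the two. The left end \<open>u\<close> must avoid
  \<open>breaks T\<close> as well, since its LCP value involves the suffix ranked just before
  it.\<close>

lemma interval_LF:
  assumes "u \<le> v" "v < length T" "{u..v} \<inter> breaks T = {}"
  shows "\<exists>u'. \<forall>i \<le> v - u. u' + i < length T \<and> Suc (SA T (Suc (u' + i))) = SA T (Suc (u + i)) \<and>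
     lcp0 T (u' + i) = Suc (lcp0 T (u + i))"
  using assms
proof (induction v rule: dec_induct)
  case base
  then have "u \<notin> breaks T" by simp
  moreover have "0 < u" using calculation base by (auto simp: breaks_def intro!: Nat.gr0I)
  ultimately show ?case using adjacent_predecessors[of u T] base by auto
next
  case (step v)
  have "{u..v} \<inter> breaks T = {}" using step.prems by (auto simp: disjoint_iff)
  then obtain u' where u': "\<And>i. i \<le> v - u \<Longrightarrow> u' + i < length T \<and>
      Suc (SA T (Suc (u' + i))) = SA T (Suc (u + i)) \<and> lcp0 T (u' + i) = Suc (lcp0 T (u + i))"
    using step.IH step.prems by auto
  obtain j where j: "0 < j" "j < length T" "Suc (SA T (Suc j)) = SA T (Suc (Suc v))"
     "Suc (SA T j) = SA T (Suc v)" "lcp0 T j = Suc (lcp0 T (Suc v))"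
    using adjacent_predecessors[of "Suc v" T] step.prems step.hyps by (auto simp: disjoint_iff)
  have "j - 1 = u' + (v - u)"
    using SA_inj[of T "j - 1" "u' + (v - u)"] u'[of "v - u"] j(1,2,4) step.hyps by simp
  then have j': "j = u' + Suc (v - u)" "Suc v - u = Suc (v - u)" "Suc v = u + Suc (v - u)"
    using j(1) step.hyps by linarith+
  show ?case
  proof (intro exI[of _ u'] allI impI)
    fix i assume "i \<le> Suc v - u"
    then consider "i \<le> v - u" | "u' + i = j" "u + i = Suc v" using j' by linarith
    then show "u' + i < length T \<and> Suc (SA T (Suc (u' + i))) = SA T (Suc (u + i)) \<and>
        lcp0 T (u' + i) = Suc (lcp0 T (u + i))"
      by cases (use u' j(2,3,5) in simp_all)
  qed
qed

lemma length_longest_common_prefix_le_left: "length (longest_common_prefix xs ys) \<le> length xs"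
  by (induction xs ys rule: longest_common_prefix.induct) auto

lemma length_longest_common_prefix_le_right: "length (longest_common_prefix xs ys) \<le> length ys"
  by (induction xs ys rule: longest_common_prefix.induct) auto

text \<open>Of two neighbouring suffixes at most one is the whole text, so the other bounds their
  common prefix. This is what makes the iteration of LF terminate.\<close>

lemma lcp0_less:
  assumes "k < length T" shows "lcp0 T k < length T"
proof (cases "k = 0")
  case True then show ?thesis using assms by (auto simp: lcp0_def LCP_def)
next
  case False
  then have "SA T (Suc k) \<noteq> SA T (Suc (k - 1))" using SA_inj[of T k "k - 1"] assms by fastforce
  moreover have "SA T (Suc k) \<in> {1..length T}" "SA T (Suc (k - 1)) \<in> {1..length T}"
    using SA_in[of k T] SA_in[of "k-1" T] assms by auto
  ultimately have "length (suf T k) < length T \<or> length (suf T (k - 1)) < length T"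
    by (auto simp: suf_def suffix_at_def)
  then show ?thesis
    using length_longest_common_prefix_le_left[of "suf T k" "suf T (k-1)"] length_longest_common_prefix_le_right[of "suf T k" "suf T (k-1)"] False
    by (auto simp: lcp0_def LCP_def suf_def)
qed

text \<open>Every application of LF to an interval without breaks raises its LCP values by 1, which
  \<open>lcp0_less\<close> permits only finitely often. The increment \<open>s\<close> is the number
  of applications.\<close>

lemma interval_copy_at_break:
  assumes "u \<le> v" "v < length T"
  shows "\<exists>u' s p. p \<in> breaks T \<and> u' \<le> p \<and> p \<le> u' + (v - u) \<and> u' + (v - u) < length T \<and>
     (\<forall>i \<le> v - u. lcp0 T (u' + i) = lcp0 T (u + i) + s)"
  using assms
proof (induction "length T - lcp0 T u" arbitrary: u v rule: less_induct)
  case less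
  show ?case
  proof (cases "{u..v} \<inter> breaks T = {}")
    case False
    then obtain p where "p \<in> breaks T" "u \<le> p" "p \<le> v" by auto
    then show ?thesis using less.prems by (intro exI[of _ u] exI[of _ 0] exI[of _ p]) auto
  next
    case True
    then obtain u1 where u1: "\<And>i. i \<le> v - u \<Longrightarrow> u1 + i < length T \<and> lcp0 T (u1 + i) = Suc (lcp0 T (u + i))"
      using interval_LF[of u v T] less.prems by blast
    have "length T - lcp0 T u1 < length T - lcp0 T u"
      using u1[of 0] lcp0_less[of u T] less.prems by auto
    then obtain u' s p where "p \<in> breaks T" "u' \<le> p" "p \<le> u' + (v - u)" "u' + (v - u) < length T"
       "\<And>i. i \<le> v - u \<Longrightarrow> lcp0 T (u' + i) = lcp0 T (u1 + i) + s"
      using less.hyps[of u1 "u1 + (v - u)"] u1 by auto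
    then show ?thesis using u1 by (intro exI[of _ u'] exI[of _ "Suc s"] exI[of _ p]) auto
  qed
qed

section \<open>Counting the break positions\<close>

lemma finite_maximal_runs: "finite (maximal_runs n X)"
  by (rule finite_subset[of _ "{1..n} \<times> {1..n}"]) (auto simp: maximal_runs_def equal_letter_run_def)

text \<open>Extending to the right from \<open>Suc k\<close> as long as the letter stays the same
  gives a run that cannot grow to the left, because the letter at \<open>k\<close> differs. Ranks
  are 0-based and runs 1-based, hence \<open>i - 1\<close>.\<close>

lemma run_starts_subset:
  "{k. k < n \<and> (k = 0 \<or> X (Suc k) \<noteq> X k)} \<subseteq> (\<lambda>(i, j). i - 1) ` maximal_runs n X"
proof
  fix k assume "k \<in> {k. k < n \<and> (k = 0 \<or> X (Suc k) \<noteq> X k)}"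
  then have k: "k < n" "k = 0 \<or> X (Suc k) \<noteq> X k" by auto
  define J where "J = {j. equal_letter_run n X (Suc k) j}"
  have J: "finite J" "Suc k \<in> J" using k
    by (auto simp: J_def equal_letter_run_def intro: finite_subset[of _ "{..n}"])
  then have M: "Max J \<in> J" by (intro Max_in) auto
  have "(Suc k, Max J) \<in> maximal_runs n X"
    unfolding maximal_runs_def
  proof (clarify, intro conjI allI impI)
    show "equal_letter_run n X (Suc k) (Max J)" using M by (simp add: J_def)
    fix i' j' assume a: "equal_letter_run n X i' j' \<and> i' \<le> Suc k \<and> Max J \<le> j'"
    have kj: "Suc k \<le> j'" using a Max_ge[OF J] by linarith
    show i: "i' = Suc k"
    proof (rule ccontr)
      assume "i' \<noteq> Suc k"
      then have "k \<in> {i'..j'}" "Suc k \<in> {i'..j'}" "1 \<le> i'" "i' \<le> k"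
        using a kj unfolding equal_letter_run_def by auto
      moreover have "\<forall>l\<in>{i'..j'}. X l = X i'" using a unfolding equal_letter_run_def by blast
      ultimately have "X k = X i'" "X (Suc k) = X i'" "k \<noteq> 0" by (blast, blast, linarith)
      then show False using k by simp
    qed
    show "j' = Max J" using a i Max_ge[OF J(1), of j'] by (simp add: J_def)
  qed
  then show "k \<in> (\<lambda>(i, j). i - 1) ` maximal_runs n X" by force
qed

lemma card_le_1_if_all_equal: "(\<And>x y. x \<in> A \<Longrightarrow> y \<in> A \<Longrightarrow> x = y) \<Longrightarrow> card A \<le> 1"
  by (metis One_nat_def card.infinite card_le_Suc0_iff_eq le_numeral_extra(3) zero_le_one)

lemma bwt_runs_pos: "T \<noteq> [] \<Longrightarrow> 1 \<le> bwt_runs T"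
  using run_starts_subset[of "length T" "BWT T"] finite_maximal_runs[of "length T" "BWT T"]
  by (auto simp: bwt_runs_def Suc_le_eq card_gt_0_iff)

text \<open>Besides the run starts, only the rank of the suffix starting at position 1 and the rank
  after it can be breaks. These two are absorbed by the factor 3 because there is at least one
  run.\<close>

lemma card_breaks:
  assumes "T \<noteq> []" shows "card (breaks T) \<le> 3 * bwt_runs T"
proof -
  let ?n = "length T"
  let ?A = "{k. k < ?n \<and> (k = 0 \<or> BWT T (Suc k) \<noteq> BWT T k)}"
  let ?B = "{k. k < ?n \<and> SA T (Suc k) = 1}"
  let ?C = "{k. k < ?n \<and> 0 < k \<and> SA T k = 1}"
  have "card ?A \<le> bwt_runs T"
    using surj_card_le[OF finite_maximal_runs run_starts_subset] by (simp add: bwt_runs_def)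
  moreover have "card ?B \<le> 1" by (rule card_le_1_if_all_equal) (use SA_inj[of T] in auto)
  moreover have "card ?C \<le> 1"
  proof (rule card_le_1_if_all_equal)
    fix x y assume "x \<in> ?C" "y \<in> ?C"
    then have "x - 1 = y - 1" "0 < x" "0 < y" using SA_inj[of T "x - 1" "y - 1"] by auto
    then show "x = y" by linarith
  qed
  moreover have "card (breaks T) \<le> card (?A \<union> (?B \<union> ?C))"
    by (rule card_mono) (auto simp: breaks_def)
  moreover have "card (?A \<union> (?B \<union> ?C)) \<le> card ?A + (card ?B + card ?C)"
    by (meson add_left_mono card_Un_le order_trans)
  ultimately show ?thesis using bwt_runs_pos[OF assms] by linarith
qed

text \<open>The second component of the pairs resolves ties towards the smaller index. The 0-based
  range \<open>{b..<e}\<close> is the 1-based range \<open>{b<..e}\<close>, hence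
  \<open>Suc q\<close>.\<close>

lemma LCP_argmin_eq:
  assumes "b < e" "Min ((\<lambda>k. (lcp0 T k, k)) ` {b..<e}) = (v, q)"
  shows "LCP_argmin T b e = Suc q"
proof -
  let ?K = "(\<lambda>k. (lcp0 T k, k)) ` {b..<e}"
  have "finite ?K" "?K \<noteq> {}" using assms by auto
  then have "(v, q) \<in> ?K" and le: "\<And>k. b \<le> k \<Longrightarrow> k < e \<Longrightarrow> (v, q) \<le> (lcp0 T k, k)"
    unfolding assms(2)[symmetric] by (auto simp del: Min_le_iff intro: Min_in Min_le)
  then have q: "b \<le> q" "q < e" "v = lcp0 T q" by auto
  show ?thesis unfolding LCP_argmin_def
  proof (rule Least_equality, intro conjI ballI)
    show "Suc q \<in> {b<..e}" using q by auto
    fix j assume "j \<in> {b<..e}"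
    then have "b \<le> j - 1" "j - 1 < e" "0 < j" by auto
    then show "LCP T (Suc q) \<le> LCP T j" using le[of "j - 1"] q by (auto simp: lcp0_def less_eq_prod_def)
  next
    fix i assume i: "i \<in> {b<..e} \<and> (\<forall>j\<in>{b<..e}. LCP T i \<le> LCP T j)"
    then have "LCP T i \<le> LCP T (Suc q)" using q by auto
    moreover have "b \<le> i - 1" "i - 1 < e" "0 < i" using i by auto
    ultimately show "Suc q \<le> i" using le[of "i - 1"] q by (auto simp: lcp0_def less_eq_prod_def)
  qed
qed

section \<open>The query program\<close>

text \<open>
  Instructions 11--43 follow both query ends through block records, 44--96 follow one end through
  side records, 97--105 switch from the left to the right end, and 110 is the table lookup used
  when the word size is at most \<open>\<kappa>\<close> (recognised by \<open>2 ^ \<kappa>\<close> being 0 as a word).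

  Registers: 0, 1 query ends in the current copy; 7, 8 the same ends in the original array; 2, 3 address of
  the current record; 4 the accumulated LCP increment of the copy; 9, 10 value and position of the best candidate;
  14, 15 those of the new candidate; 18, 19, 20 increment and record address saved for the right end;
  21 is 1 when the right end is processed; 22 is 1 when the current side is finished;
  5, 6, 23, 24 hold the constants 1, 0, 8, 16.
\<close>

definition prog :: "nat \<Rightarrow> ram_program" where
  "prog \<kappa> =
   [Const 25 (2 ^ \<kappa>), Jump_eq 25 6 110, Const 5 1, Const 23 8, Const 24 16,
    Arith SUB 1 1 5, Move 7 0, Move 8 1, Jump_eq 0 1 108, Arith SUB 9 6 5, Move 10 9,
    Load 11 2 3, Arith ADD 12 3 5, Load 13 2 12, Arith ADD 0 0 13, Arith ADD 1 1 13,
    Arith ADD 12 12 5, Load 13 2 12, Arith ADD 4 4 13, Arith ADD 12 12 5, Load 13 2 12,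
    Arith SHR 16 0 11, Arith SHR 17 1 11, Arith SUB 14 17 13, Arith MUL 14 14 23,
    Arith ADD 14 14 24, Arith ADD 14 14 3, Jump_less 16 17 33,
    Load 19 2 14, Arith ADD 14 14 5, Load 3 2 14, Move 2 19, Jump 11,
    Arith ADD 14 14 5, Arith ADD 14 14 5, Load 19 2 14, Arith ADD 14 14 5, Load 20 2 14,
    Arith ADD 14 14 5, Load 13 2 14, Arith ADD 14 14 5, Load 3 2 14, Move 2 13, Move 18 4,
    Load 13 2 3, Arith ADD 12 3 5, Load 14 2 12, Arith SUB 13 0 13, Arith MUL 13 13 14,
    Arith ADD 12 12 5, Load 14 2 12, Move 15 7, Jump_eq 13 6 88,
    Arith ADD 12 12 5, Load 11 2 12, Arith SHR 13 13 11, Arith ADD 12 12 5, Jump_eq 13 6 83,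
    Arith ADD 12 12 5, Arith ADD 12 12 5, Load 13 2 12, Arith ADD 0 0 13, Arith ADD 12 12 5,
    Load 13 2 12, Arith ADD 4 4 13, Arith ADD 12 12 5, Load 13 2 12, Arith SHR 16 0 11,
    Arith SUB 16 16 13, Arith MUL 16 16 23, Arith ADD 16 16 24, Arith ADD 12 16 3,
    Load 14 2 12, Arith ADD 12 12 5, Load 15 2 12, Arith ADD 15 15 7, Arith SUB 15 15 0,
    Arith ADD 12 12 5, Load 13 2 12, Arith ADD 12 12 5, Load 3 2 12, Move 2 13, Jump 89,
    Load 13 2 12, Arith ADD 12 12 5, Load 3 2 12, Move 2 13, Jump 44,
    Move 22 5,
    Arith SUB 14 14 4, Jump_less 14 9 94, Jump_less 9 14 96, Jump_less 15 10 94, Jump 96,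
    Move 9 14, Move 10 15, Jump_eq 22 6 44,
    Jump_eq 21 5 106, Move 21 5, Move 22 6, Move 0 1, Move 7 8, Move 2 19, Move 3 20,
    Move 4 18, Jump 44,
    Arith ADD 0 10 5, Jump 111,
    Arith ADD 0 1 5, Jump 111,
    Load 0 0 1]"

section \<open>Symbolic execution of program segments\<close>

lemma length_prog [simp]: "length (prog \<kappa>) = 111"
  by (simp add: prog_def)

lemma step_prog:
  "pc s < 111 \<Longrightarrow> step w (prog \<kappa>) s = exec_instr w (prog \<kappa> ! pc s) s"
  by (simp add: step_def halted_def)

text \<open>This form unfolds the program only where an instruction is fetched; inside iterated
  \<open>step\<close> it stays folded.\<close>

lemmas prog_nth = arg_cong[where f = "\<lambda>P. P ! i" for i, OF prog_def]

lemma funpow_numeral_apply: "(f ^^ numeral k) s = (f ^^ pred_numeral k) (f s)"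
  by (simp add: numeral_eq_Suc funpow_Suc_right del: funpow.simps)

text \<open>
  Addition that the simplifier leaves alone, so that addresses keep the form base plus numeral during
  symbolic execution.
\<close>

definition off :: "nat \<Rightarrow> nat \<Rightarrow> nat" where
  "off l k = l + k"

lemma off_Suc:
  "l + 1 < 2 ^ w \<Longrightarrow> Suc (off l 0) mod 2 ^ w = off l (Suc 0)"
  "l + 2 < 2 ^ w \<Longrightarrow> Suc (off l (Suc 0)) mod 2 ^ w = off l 2"
  "l + numeral (k + num.One) < 2 ^ w \<Longrightarrow>
     Suc (off l (numeral k)) mod 2 ^ w = off l (numeral (k + num.One))"
  by (simp_all add: off_def flip: Suc_numeral)

lemmas run_simps = step_prog prog_nth set_reg_def address_def funpow_numeral_apply off_Suc

definition consts_ok :: "(nat \<Rightarrow> nat) \<Rightarrow> bool" where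
  "consts_ok g \<longleftrightarrow> g 5 = 1 \<and> g 6 = 0 \<and> g 23 = 8 \<and> g 24 = 16"

definition runs :: "nat \<Rightarrow> nat \<Rightarrow> (nat \<Rightarrow> nat) \<Rightarrow> nat \<Rightarrow> nat \<Rightarrow> (nat \<Rightarrow> nat) \<Rightarrow> nat \<Rightarrow> (nat \<Rightarrow> nat) \<Rightarrow> bool" where
  "runs w \<kappa> m k p g p' g' \<longleftrightarrow>
     (step w (prog \<kappa>) ^^ k) \<lparr>pc = p, regs = g, mem = m\<rparr> = \<lparr>pc = p', regs = g', mem = m\<rparr>"

lemma runs_trans:
  "runs w \<kappa> m k p g p' g' \<Longrightarrow> runs w \<kappa> m k' p' g' p'' g'' \<Longrightarrow> runs w \<kappa> m (k + k') p g p'' g''"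
  by (simp add: runs_def funpow_add add.commute[of k k'])

text \<open>A right end equal to the word range \<open>W\<close> arrives in the register as 0; the
  wraparound of the subtraction still yields the last 0-based position.\<close>

lemma pred_mod_word: "1 \<le> y \<Longrightarrow> y \<le> W \<Longrightarrow> (y mod W + W - 1) mod W = y - (1::nat)"
  by (cases "y = W") (auto simp: mod_if)

lemma prog_init_jump:
  assumes "(2::nat) ^ \<kappa> mod 2 ^ w = c" "c \<noteq> 0" "g 6 = 0"
  shows "runs w \<kappa> m 2 0 g 2 (g(25 := c))"
  using assms by (simp add: run_simps runs_def)

lemma prog_init_consts:
  assumes "16 < (2::nat) ^ w" "(g 1 + 2 ^ w - 1) mod 2 ^ w = y" "g 0 = x"
  shows "\<exists>g'. runs w \<kappa> m 7 2 g (if x = y then 108 else 9) g' \<and> g' 5 = 1 \<and> g' 23 = 8 \<and> g' 24 = 16 \<and>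
     g' 1 = y \<and> g' 7 = x \<and> g' 8 = y \<and> (\<forall>i. i \<notin> {1, 5, 7, 8, 23, 24} \<longrightarrow> g' i = g i)"
proof -
  have "w \<noteq> 0" using assms(1) by (rule contrapos_pn) simp
  then show ?thesis using assms by (simp add: run_simps runs_def)
qed

text \<open>The subtraction 0 - 1 wraps around to the largest word, which serves as infinity for the
  best candidate.\<close>

lemma prog_init_best:
  assumes "g 6 = 0" "g 5 = 1" "1 < (2::nat) ^ w"
  shows "runs w \<kappa> m 2 9 g 11 (g(9 := 2 ^ w - 1, 10 := 2 ^ w - 1))"
  using assms by (simp add: run_simps runs_def)

lemma prog_init_single:
  assumes "g 5 = 1"
  shows "runs w \<kappa> m 2 108 g 111 (g(0 := (g 1 + 1) mod 2 ^ w))"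
  using assms by (simp add: run_simps runs_def)

lemma prog_init:
  assumes c: "2 ^ \<kappa> mod 2 ^ w \<noteq> (0::nat)" "16 < (2::nat) ^ w" "1 \<le> y" "y \<le> 2 ^ w" "x < 2 ^ w" "x \<noteq> y - 1"
  shows "\<exists>g. runs w \<kappa> m 11 0 ((\<lambda>_. 0)(0 := x mod 2 ^ w, 1 := y mod 2 ^ w)) 11 g \<and> consts_ok g \<and>
    g 0 = x \<and> g 7 = x \<and> g 1 = y - 1 \<and> g 8 = y - 1 \<and> g 9 = 2 ^ w - 1 \<and> g 10 = 2 ^ w - 1 \<and>
    g 2 = 0 \<and> g 3 = 0 \<and> g 4 = 0 \<and> g 21 = 0 \<and> g 22 = 0"
proof -
  define g0 :: "nat \<Rightarrow> nat" where "g0 = (\<lambda>_. 0)(0 := x mod 2 ^ w, 1 := y mod 2 ^ w)"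
  define c where "c = (2::nat) ^ \<kappa> mod 2 ^ w"
  have 1: "runs w \<kappa> m 2 0 g0 2 (g0(25 := c))"
    using assms by (intro prog_init_jump) (auto simp: g0_def c_def)
  obtain g1 where g1: "runs w \<kappa> m 7 2 (g0(25 := c)) 9 g1" "g1 5 = 1" "g1 23 = 8" "g1 24 = 16"
     "g1 1 = y - 1" "g1 7 = x" "g1 8 = y - 1"
     "\<forall>i. i \<notin> {1, 5, 7, 8, 23, 24} \<longrightarrow> g1 i = (g0(25 := c)) i"
    using prog_init_consts[of w "g0(25 := c)" "y - 1" x \<kappa> m] pred_mod_word[of y "2 ^ w"] assms
    by (auto simp: g0_def)
  have g1': "g1 0 = x" "g1 2 = 0" "g1 3 = 0" "g1 4 = 0" "g1 21 = 0" "g1 22 = 0" "g1 6 = 0"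
    using g1(8) assms by (auto simp: g0_def)
  show ?thesis
    using runs_trans[OF runs_trans[OF 1 g1(1)] prog_init_best[of g1]] g1 g1' assms
    by (intro exI[of _ "g1(9 := 2 ^ w - 1, 10 := 2 ^ w - 1)"]) (simp add: g0_def consts_ok_def)
qed

lemma prog_single:
  assumes "2 ^ \<kappa> mod 2 ^ w \<noteq> (0::nat)" "16 < (2::nat) ^ w" "1 \<le> y" "y \<le> 2 ^ w" "x = y - 1"
  shows "\<exists>g. runs w \<kappa> m 11 0 ((\<lambda>_. 0)(0 := x mod 2 ^ w, 1 := y mod 2 ^ w)) 111 g \<and> g 0 = y mod 2 ^ w"
proof -
  define g0 :: "nat \<Rightarrow> nat" where "g0 = (\<lambda>_. 0)(0 := x mod 2 ^ w, 1 := y mod 2 ^ w)"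
  define c where "c = (2::nat) ^ \<kappa> mod 2 ^ w"
  have x: "x < 2 ^ w" using assms by auto
  have 1: "runs w \<kappa> m 2 0 g0 2 (g0(25 := c))"
    using assms by (intro prog_init_jump) (auto simp: g0_def c_def)
  obtain g1 where g1: "runs w \<kappa> m 7 2 (g0(25 := c)) 108 g1" "g1 5 = 1" "g1 1 = y - 1"
    using prog_init_consts[of w "g0(25 := c)" "y - 1" x \<kappa> m] pred_mod_word[of y "2 ^ w"] assms x
    by (auto simp: g0_def)
  show ?thesis
    using runs_trans[OF runs_trans[OF 1 g1(1)] prog_init_single[of g1]] g1 assms
    by (intro exI[of _ "g1(0 := (g1 1 + 1) mod 2 ^ w)"]) (simp add: g0_def)
qed

lemma prog_table:
  assumes "2 ^ \<kappa> mod 2 ^ w = (0::nat)" "g 6 = 0"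
  shows "runs w \<kappa> m 3 0 g 111 (g(25 := 0, 0 := m (g 0 * 2 ^ w + g 1)))"
proof -
  have "runs w \<kappa> m 2 0 g 110 (g(25 := 0))"
    unfolding runs_def using assms(2)
    by (simp add: step_prog prog_nth set_reg_def funpow_numeral_apply assms(1))
  moreover have "runs w \<kappa> m 1 110 (g(25 := 0)) 111 (g(25 := 0, 0 := m (g 0 * 2 ^ w + g 1)))"
    by (simp add: run_simps runs_def)
  ultimately show ?thesis using runs_trans by fastforce
qed

text \<open>The words \<open>e1\<close> to \<open>e4\<close> are the successive results of the
  address computation. They enter as variables to keep modular arithmetic out of the symbolic
  execution; \<open>entry_address\<close> supplies their values.\<close>

lemma prog_block:
  assumes "consts_ok g" "l + 3 < 2 ^ w" "g 2 = h" "g 3 = off l 0"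
    and c: "\<And>k. m (h * 2 ^ w + off l k) = c k"
    and x': "(g 0 + c 1) mod 2 ^ w = x'" "(g 1 + c 1) mod 2 ^ w = y'"
    and mx: "x' div 2 ^ c 0 = mx" "y' div 2 ^ c 0 = my"
    and e: "(my + 2 ^ w - c 3) mod 2 ^ w = e1" "(e1 * 8) mod 2 ^ w = e2"
      "(e2 + 16) mod 2 ^ w = e3" "(e3 + off l 0) mod 2 ^ w = e4"
  shows "\<exists>g'. runs w \<kappa> m 17 11 g (if mx < my then 33 else 28) g' \<and>
   consts_ok g' \<and> g' 0 = x' \<and> g' 1 = y' \<and> g' 4 = (g 4 + c 2) mod 2 ^ w \<and> g' 14 = e4 \<and>
   (\<forall>i. i \<notin> {0, 1, 4, 11, 12, 13, 14, 16, 17} \<longrightarrow> g' i = g i)"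
proof -
  have "g 5 = Suc 0" "g 6 = 0" "g 23 = 8" "g 24 = 16" using assms(1) by (simp_all add: consts_ok_def)
  moreover note assms(2-4)
  ultimately show ?thesis using x' mx e unfolding consts_ok_def runs_def
    by (simp add: run_simps c)
qed

lemma prog_block_descend:
  assumes "consts_ok g" "g 14 = off e 0" "e + 1 < 2 ^ w"
    and c: "\<And>k. c k = m (g 2 * 2 ^ w + off e k)"
  shows "\<exists>g'. runs w \<kappa> m 5 28 g 11 g' \<and> consts_ok g' \<and> g' 2 = c 0 \<and> g' 3 = c 1 \<and>
   (\<forall>i. i \<notin> {2, 3, 14, 19} \<longrightarrow> g' i = g i)"
  using assms(1-3) unfolding c consts_ok_def runs_def
  by (simp add: run_simps)

lemma prog_block_split:
  assumes "consts_ok g" "g 14 = off e 0" "e + 5 < 2 ^ w"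
    and c: "\<And>k. c k = m (g 2 * 2 ^ w + off e k)"
  shows "\<exists>g'. runs w \<kappa> m 11 33 g 44 g' \<and> consts_ok g' \<and> g' 19 = c 2 \<and> g' 20 = c 3 \<and>
    g' 2 = c 4 \<and> g' 3 = c 5 \<and> g' 18 = g 4 \<and>
   (\<forall>i. i \<notin> {2, 3, 13, 14, 18, 19, 20} \<longrightarrow> g' i = g i)"
  using assms(1-3) unfolding c consts_ok_def runs_def
  by (simp add: run_simps)

lemma prog_side:
  assumes "consts_ok g" "l + 2 < 2 ^ w" "g 2 = h" "g 3 = off l 0"
    and c: "\<And>k. m (h * 2 ^ w + off l k) = c k"
    and z: "(g 0 + 2 ^ w - c 0) mod 2 ^ w = z1" "(z1 * c 1) mod 2 ^ w = z"
  shows "\<exists>g'. runs w \<kappa> m 9 44 g (if z = 0 then 88 else 53) g' \<and>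
   consts_ok g' \<and> g' 13 = z \<and> g' 14 = c 2 \<and> g' 15 = g 7 \<and> g' 12 = off l 2 \<and>
   (\<forall>i. i \<notin> {12, 13, 14, 15} \<longrightarrow> g' i = g i)"
proof -
  have "g 5 = Suc 0" "g 6 = 0" "g 23 = 8" "g 24 = 16" using assms(1) by (simp_all add: consts_ok_def)
  moreover note assms(2-4)
  ultimately show ?thesis using z unfolding consts_ok_def runs_def
    by (simp add: run_simps c)
qed

lemma prog_side_level:
  assumes "consts_ok g" "l + 4 < 2 ^ w" "g 2 = h" "g 12 = off l 2"
    and c: "\<And>k. m (h * 2 ^ w + off l k) = c k" and z: "g 13 div 2 ^ c 3 = z"
  shows "\<exists>g'. runs w \<kappa> m 5 53 g (if z = 0 then 83 else 58) g' \<and>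
   consts_ok g' \<and> g' 12 = off l 4 \<and> g' 11 = c 3 \<and>
   (\<forall>i. i \<notin> {11, 12, 13} \<longrightarrow> g' i = g i)"
proof -
  have "g 5 = Suc 0" "g 6 = 0" "g 23 = 8" "g 24 = 16" using assms(1) by (simp_all add: consts_ok_def)
  moreover note assms(2-4)
  ultimately show ?thesis using z unfolding consts_ok_def runs_def
    by (simp add: run_simps c)
qed

lemma prog_side_down:
  assumes "consts_ok g" "l + 5 < 2 ^ w" "g 2 = h" "g 12 = off l 4"
    and c: "\<And>k. c k = m (h * 2 ^ w + off l k)"
  shows "\<exists>g'. runs w \<kappa> m 5 83 g 44 g' \<and> consts_ok g' \<and> g' 2 = c 4 \<and> g' 3 = c 5 \<and>
   (\<forall>i. i \<notin> {2, 3, 12, 13} \<longrightarrow> g' i = g i)"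
  using assms(1-4) unfolding c consts_ok_def runs_def
  by (simp add: run_simps)

lemma prog_side_shift:
  assumes "consts_ok g" "l + 8 < 2 ^ w" "g 2 = h" "g 3 = off l 0" "g 12 = off l 4"
    and c: "\<And>k. m (h * 2 ^ w + off l k) = c k"
    and x': "(g 0 + c 6) mod 2 ^ w = x'" "x' div 2 ^ g 11 = mx"
    and e: "(mx + 2 ^ w - c 8) mod 2 ^ w = e1" "(e1 * 8) mod 2 ^ w = e2"
      "(e2 + 16) mod 2 ^ w = e3" "(e3 + off l 0) mod 2 ^ w = e4"
  shows "\<exists>g'. runs w \<kappa> m 14 58 g 72 g' \<and> consts_ok g' \<and> g' 0 = x' \<and> g' 4 = (g 4 + c 7) mod 2 ^ w \<and>
   g' 12 = e4 \<and> (\<forall>i. i \<notin> {0, 4, 12, 13, 16} \<longrightarrow> g' i = g i)"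
proof -
  have "g 5 = Suc 0" "g 6 = 0" "g 23 = 8" "g 24 = 16" using assms(1) by (simp_all add: consts_ok_def)
  moreover note assms(2-5)
  ultimately show ?thesis using x' e unfolding consts_ok_def runs_def
    by (simp add: run_simps c)
qed

lemma prog_side_entry:
  assumes "consts_ok g" "e + 3 < 2 ^ w" "g 12 = off e 0"
    and c: "\<And>k. c k = m (g 2 * 2 ^ w + off e k)"
  shows "\<exists>g'. runs w \<kappa> m 11 72 g 89 g' \<and> consts_ok g' \<and> g' 14 = c 0 \<and>
    g' 15 = ((c 1 + g 7) mod 2 ^ w + 2 ^ w - g 0) mod 2 ^ w \<and> g' 2 = c 2 \<and> g' 3 = c 3 \<and>
   (\<forall>i. i \<notin> {2, 3, 12, 13, 14, 15} \<longrightarrow> g' i = g i)"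
  using assms(1-3) unfolding c consts_ok_def runs_def
  by (simp add: run_simps)

lemma prog_side_base:
  assumes "consts_ok g"
  shows "\<exists>g'. runs w \<kappa> m 1 88 g 89 g' \<and> consts_ok g' \<and> g' 22 = 1 \<and> (\<forall>i. i \<noteq> 22 \<longrightarrow> g' i = g i)"
  using assms unfolding consts_ok_def runs_def
  by (simp add: run_simps)

text \<open>Subtracting register 4 turns the value of the candidate into a value of the original
  array; the jumps then compare (value, position) lexicographically. The longest path is a tie in
  the value that the candidate wins by its position.\<close>

lemma prog_compare:
  assumes "consts_ok g" "(g 14 + 2 ^ w - g 4) mod 2 ^ w = v"
  shows "\<exists>k g'. k \<le> 7 \<and> runs w \<kappa> m k 89 g (if g 22 = 0 then 44 else 97) g' \<and> consts_ok g' \<and>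
    (g' 9, g' 10) = min (g 9, g 10) (v, g 15) \<and>
   (\<forall>i. i \<notin> {9, 10, 14} \<longrightarrow> g' i = g i)"
proof -
  have 1: "runs w \<kappa> m 1 89 g 90 (g(14 := v))"
    using assms by (simp add: run_simps runs_def)
  define g1 where "g1 = g(14 := v)"
  have g1: "g1 14 = v" "g1 9 = g 9" "g1 10 = g 10" "g1 15 = g 15" by (auto simp: g1_def)
  have 2: "runs w \<kappa> m 3 94 g1 (if g1 22 = g1 6 then 44 else 97) (g1(9 := v, 10 := g 15))"
    using g1 by (simp add: run_simps runs_def)
  have 3: "runs w \<kappa> m 1 96 g1 (if g1 22 = g1 6 then 44 else 97) g1"
    by (simp add: run_simps runs_def)
  have co: "consts_ok (g1(9 := v, 10 := g 15))" "consts_ok g1" "g1 22 = g 22" "g1 6 = 0"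
    using assms(1) by (auto simp: consts_ok_def g1_def)
  consider (a) "v < g 9" | (b) "\<not> v < g 9" "g 9 < v" | (c) "v = g 9" "g 15 < g 10"
    | (d) "v = g 9" "\<not> g 15 < g 10"
    by linarith
  then show ?thesis
  proof cases
    case a
    then have "runs w \<kappa> m 1 90 g1 94 g1" using g1 by (simp add: run_simps runs_def)
    from runs_trans[OF 1[folded g1_def] runs_trans[OF this 2]] show ?thesis
      using a co by (intro exI[of _ 5] exI[of _ "g1(9 := v, 10 := g 15)"]) (auto simp: min_def g1_def)
  next
    case b
    then have "runs w \<kappa> m 2 90 g1 96 g1" using g1 by (simp add: run_simps runs_def)
    from runs_trans[OF 1[folded g1_def] runs_trans[OF this 3]] show ?thesis
      using b co by (intro exI[of _ 4] exI[of _ g1]) (auto simp: min_def g1_def)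
  next
    case c
    then have "runs w \<kappa> m 3 90 g1 94 g1" using g1 by (simp add: run_simps runs_def)
    from runs_trans[OF 1[folded g1_def] runs_trans[OF this 2]] show ?thesis
      using c co by (intro exI[of _ 7] exI[of _ "g1(9 := v, 10 := g 15)"]) (auto simp: min_def g1_def)
  next
    case d
    then have "runs w \<kappa> m 4 90 g1 96 g1" using g1 by (simp add: run_simps runs_def)
    from runs_trans[OF 1[folded g1_def] runs_trans[OF this 3]] show ?thesis
      using d co by (intro exI[of _ 6] exI[of _ g1]) (auto simp: min_def g1_def)
  qed
qed

lemma prog_next_side:
  assumes "consts_ok g" "g 21 = 0"
  shows "\<exists>g'. runs w \<kappa> m 9 97 g 44 g' \<and> consts_ok g' \<and> g' 21 = 1 \<and> g' 22 = 0 \<and> g' 0 = g 1 \<and>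
    g' 7 = g 8 \<and> g' 2 = g 19 \<and> g' 3 = g 20 \<and> g' 4 = g 18 \<and>
    (\<forall>i. i \<notin> {21, 22, 0, 7, 2, 3, 4} \<longrightarrow> g' i = g i)"
  using assms unfolding consts_ok_def runs_def
  by (simp add: run_simps)

lemma prog_finish:
  assumes "consts_ok g" "g 21 = 1"
  shows "\<exists>g'. runs w \<kappa> m 3 97 g 111 g' \<and> g' 0 = (g 10 + 1) mod 2 ^ w"
  using assms unfolding consts_ok_def runs_def
  by (simp add: run_simps)

text \<open>Shifting all positions and lowering all values by constants preserves the lexicographic
  order, so it commutes with the minimum. Here \<open>xo\<close> is the original of
  \<open>x\<close>, and \<open>i + xo - x\<close> expresses a shift of either sign on natural
  numbers. That \<open>v\<close> is attained at \<open>q\<close> lets the caller rule out underflow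
  in \<open>v - K\<close>.\<close>

lemma Min_key_translate:
  fixes L :: "nat \<Rightarrow> nat"
  assumes "finite C" "C \<noteq> {}" "Min ((\<lambda>i. (L i, i)) ` C) = (v, q)"
    and tr: "\<And>i. i \<in> C \<Longrightarrow> x \<le> i + xo \<and> L i = L (i + xo - x) + K"
  shows "q \<in> C" "v = L q" "Min ((\<lambda>i. (L i, i)) ` (\<lambda>i. i + xo - x) ` C) = (v - K, q + xo - x)"
proof -
  have "(v, q) \<in> (\<lambda>i. (L i, i)) ` C"
    unfolding assms(3)[symmetric] using assms(1,2) by (intro Min_in) auto
  then show q: "q \<in> C" "v = L q" by auto
  have le: "(v, q) \<le> (L i, i)" if "i \<in> C" for i
    unfolding assms(3)[symmetric] using assms(1) that by (intro Min_le) auto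
  show "Min ((\<lambda>i. (L i, i)) ` (\<lambda>i. i + xo - x) ` C) = (v - K, q + xo - x)"
  proof (rule Min_eqI)
    show "finite ((\<lambda>i. (L i, i)) ` (\<lambda>i. i + xo - x) ` C)" using assms(1) by simp
    show "(v - K, q + xo - x) \<in> (\<lambda>i. (L i, i)) ` (\<lambda>i. i + xo - x) ` C"
      using q tr[OF q(1)] by (force simp: image_iff)
    fix p assume "p \<in> (\<lambda>i. (L i, i)) ` (\<lambda>i. i + xo - x) ` C"
    then obtain i where i: "i \<in> C" "p = (L (i + xo - x), i + xo - x)" by auto
    show "(v - K, q + xo - x) \<le> p"
      using le[OF i(1)] tr[OF i(1)] tr[OF q(1)] q(2) i(2) by (auto simp: less_eq_prod_def)
  qed
qed

text \<open>The shift \<open>su - lo\<close> can be negative and is therefore stored modulo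
  \<open>W\<close>; adding it is exact because the true result lies in the word range.\<close>

lemma word_translate:
  fixes W :: nat
  assumes "lo \<le> x" "x < W" "x - lo + su < W"
  shows "(x + (su + W - lo) mod W) mod W = x - lo + su"
proof -
  have "(x + (su + W - lo) mod W) mod W = (x + (su + W - lo)) mod W" by (rule mod_add_right_eq)
  also have "x + (su + W - lo) = (x - lo + su) + W" using assms by linarith
  finally show ?thesis using assms(3) by simp
qed

lemma word_sub:
  assumes "y \<le> x" "x < W" shows "(x + W - y) mod W = x - (y::nat)"
proof -
  have "x + W - y = (x - y) + W" using assms(1) by linarith
  moreover have "x - y < W" using assms(2) by linarith
  ultimately show ?thesis by (simp only: mod_add_self2 mod_less)
qed

text \<open>Multiplication by \<open>W - 1\<close> is negation modulo \<open>W\<close>. With 1 or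
  \<open>W - 1\<close> as a factor read from the record, the same instructions compute the distance
  to the edge for both directions.\<close>

lemma word_neg_mult:
  fixes W :: nat
  assumes "x < b" "b < W" shows "((x + W - b) mod W * (W - 1)) mod W = b - x"
proof -
  define d where "d = b - x"
  have d: "0 < d" "d < W" "x + W - b = W - d" using assms by (auto simp: d_def)
  have "(W - d) * (W - 1) = W * (W - 1 - d) + d"
  proof -
    obtain e where "W = Suc (d + e)" using d less_iff_Suc_add by auto
    then show ?thesis by (simp add: algebra_simps)
  qed
  then show ?thesis using d by (simp add: mod_less flip: d_def)
qed

section \<open>The data structure\<close>

text \<open>
  \<open>Blk a m\<close> stands for the aligned block number \<open>m\<close> of length $\tau^a$. \<open>Side a b d\<close> stands for the
  interval of length $\tau^a$ with one end at \<open>b\<close>, extending to the right of \<open>b\<close> if \<open>d\<close> holds and to the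
  left otherwise.
\<close>

datatype node = Blk nat nat | Side nat nat bool

text \<open>From the text only the copying property at the set \<open>R\<close> is kept.
  \<open>t_word\<close> makes the record length \<open>2 ^ (t + 6)\<close> a divisor of the word
  range, and \<open>tH_word\<close> lets the shift amounts that divide by a block length fit into a
  word.\<close>

locale shifted_copies =
  fixes n :: nat and L :: "nat \<Rightarrow> nat" and R :: "nat set" and t H w :: nat
  assumes n_pos: "0 < n" and L_less: "i < n \<Longrightarrow> L i < n"
    and copy: "u \<le> v \<Longrightarrow> v < n \<Longrightarrow> \<exists>u' s p. p \<in> R \<and> u' \<le> p \<and> p \<le> u' + (v - u) \<and> u' + (v - u) < n \<and>
      (\<forall>i \<le> v - u. L (u' + i) = L (u + i) + s)"
    and t_pos: "1 \<le> t" and n_le: "n \<le> 2 ^ (t * H)" and n_word: "n \<le> 2 ^ w"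
    and t_word: "t + 6 \<le> w" and tH_word: "t * H < 2 ^ w"
begin

definition len :: "nat \<Rightarrow> nat" where "len a = 2 ^ (t * a)"

abbreviation "W \<equiv> (2::nat) ^ w"

lemma len_pos [simp]: "0 < len a" by (simp add: len_def)

lemma len_0 [simp]: "len 0 = 1" by (simp add: len_def)

lemma len_Suc: "len (Suc a) = 2 ^ t * len a" by (simp add: len_def power_add)

fun lev :: "node \<Rightarrow> nat" where
  "lev (Blk a m) = a"
| "lev (Side a b d) = a"

fun lo :: "node \<Rightarrow> nat" where
  "lo (Blk a m) = m * len a"
| "lo (Side a b d) = (if d then b else b + 1 - len a)"

fun hi :: "node \<Rightarrow> nat" where
  "hi (Blk a m) = min (m * len a + len a - 1) (n - 1)"
| "hi (Side a b d) = (if d then min (b + len a - 1) (n - 1) else b)"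

lemma hi_lo: "hi v - lo v < len (lev v)"
proof (cases v)
  case (Blk a m) then show ?thesis using len_pos[of a] by (simp; linarith)
next
  case (Side a b d) then show ?thesis using len_pos[of a] by (cases d; simp; linarith)
qed

definition is_copy :: "node \<Rightarrow> nat \<times> nat \<times> nat \<Rightarrow> bool" where
  "is_copy v = (\<lambda>(u, s, p). p \<in> R \<and> u \<le> p \<and> p \<le> u + (hi v - lo v) \<and> u + (hi v - lo v) < n \<and>
      (\<forall>i \<le> hi v - lo v. L (u + i) = L (lo v + i) + s))"

text \<open>All three projections are taken of the same chosen triple, so position, increment and
  boundary belong to one copy.\<close>

definition copy_pos :: "node \<Rightarrow> nat" where "copy_pos v = fst (SOME c. is_copy v c)"
definition copy_add :: "node \<Rightarrow> nat" where "copy_add v = fst (snd (SOME c. is_copy v c))"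
definition copy_break :: "node \<Rightarrow> nat" where "copy_break v = snd (snd (SOME c. is_copy v c))"

definition to_copy :: "node \<Rightarrow> nat \<Rightarrow> nat" where "to_copy v x = x - lo v + copy_pos v"

lemma copy_props:
  assumes "lo v \<le> hi v" "hi v < n"
  shows "copy_break v \<in> R" "copy_pos v \<le> copy_break v" "copy_break v \<le> copy_pos v + (hi v - lo v)"
    "copy_pos v + (hi v - lo v) < n"
    "\<And>i. i \<le> hi v - lo v \<Longrightarrow> L (copy_pos v + i) = L (lo v + i) + copy_add v"
proof -
  have "\<exists>c. is_copy v c" using copy[OF assms] by (auto simp: is_copy_def)
  then have "is_copy v (SOME c. is_copy v c)" by (rule someI_ex)
  then have "is_copy v (copy_pos v, copy_add v, copy_break v)"
    by (simp add: copy_pos_def copy_add_def copy_break_def)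
  then show "copy_break v \<in> R" "copy_pos v \<le> copy_break v" "copy_break v \<le> copy_pos v + (hi v - lo v)"
    "copy_pos v + (hi v - lo v) < n"
    "\<And>i. i \<le> hi v - lo v \<Longrightarrow> L (copy_pos v + i) = L (lo v + i) + copy_add v"
    by (auto simp: is_copy_def)
qed

lemma to_copy:
  assumes "lo v \<le> x" "x \<le> hi v" "hi v < n"
  shows "to_copy v x < n" "L (to_copy v x) = L x + copy_add v"
    "(x + (copy_pos v + W - lo v) mod W) mod W = to_copy v x"
proof -
  note c = copy_props[of v]
  show 1: "to_copy v x < n" using assms c(4) by (simp add: to_copy_def)
  show "L (to_copy v x) = L x + copy_add v" using assms c(5)[of "x - lo v"]
    by (simp add: to_copy_def add.commute)
  show "(x + (copy_pos v + W - lo v) mod W) mod W = to_copy v x"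
    unfolding to_copy_def using assms 1 n_word by (intro word_translate) (auto simp: to_copy_def)
qed

text \<open>A copy of an interval of scale \<open>Suc a\<close> spans less than \<open>2 ^ t\<close>
  blocks' length of scale \<open>a\<close> and contains some \<open>p\<close> in \<open>R\<close>,
  so each of its points lies in a block at most \<open>2 ^ t\<close> away from that of
  \<open>p\<close>.\<close>

definition marked :: "nat \<Rightarrow> nat set" where
  "marked a = {m. \<exists>p\<in>R. p div len a - 2 ^ t \<le> m \<and> m \<le> p div len a + 2 ^ t}"

definition first_block :: "node \<Rightarrow> nat" where
  "first_block v = copy_break v div len (lev v - 1) - 2 ^ t"

lemma block_range:
  assumes "lev v = Suc a" "lo v \<le> x" "x \<le> hi v" "hi v < n"
  defines "m \<equiv> to_copy v x div len a"
  shows "first_block v \<le> m" "m - first_block v \<le> 2 * 2 ^ t"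
    "\<And>m'. first_block v \<le> m' \<Longrightarrow> m' \<le> m \<Longrightarrow> m' \<in> marked a"
proof -
  note c = copy_props[of v]
  let ?p = "copy_break v"
  have d: "hi v - lo v < 2 ^ t * len a" using hi_lo[of v] assms(1) by (simp add: len_Suc)
  have x: "to_copy v x \<le> ?p + 2 ^ t * len a" "?p \<le> to_copy v x + 2 ^ t * len a"
    using c d assms(2-4) by (auto simp: to_copy_def)
  have "m \<le> (?p + 2 ^ t * len a) div len a" unfolding m_def by (rule div_le_mono[OF x(1)])
  then have 1: "m \<le> ?p div len a + 2 ^ t" by simp
  have "?p div len a \<le> (to_copy v x + 2 ^ t * len a) div len a" by (rule div_le_mono[OF x(2)])
  then have 2: "?p div len a \<le> m + 2 ^ t" by (simp add: m_def)
  have fb: "first_block v = ?p div len a - 2 ^ t" by (simp add: first_block_def assms(1))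
  show "first_block v \<le> m" "m - first_block v \<le> 2 * 2 ^ t" using 1 2 fb by auto
  have "?p \<in> R" using c(1) assms by simp
  then show "\<And>m'. first_block v \<le> m' \<Longrightarrow> m' \<le> m \<Longrightarrow> m' \<in> marked a"
    using 1 fb by (auto simp: marked_def intro!: bexI[of _ ?p])
qed

text \<open>The scale \<open>a\<close> of a side and the scale \<open>a'\<close> of the block
  providing its edge vary independently: a side starts at scale \<open>H\<close> whatever its edge
  is, and the scale can drop while the edge stays.\<close>

definition nodes :: "node set" where
  "nodes = insert (Blk H 0) ({Blk a m | a m. a < H \<and> m \<in> marked a} \<union>
     {Side a (m * len a') True | a a' m. a \<le> H \<and> a' < H \<and> m \<in> marked a'} \<union>
     {Side a (m * len a' + len a' - 1) False | a a' m. a \<le> H \<and> a' < H \<and> m \<in> marked a'})"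

definition edge :: "nat \<Rightarrow> bool \<Rightarrow> nat \<Rightarrow> nat" where
  "edge a d m = (if d then m * len a else m * len a + len a - 1)"

lemma Side_in_nodes:
  "a \<le> H \<Longrightarrow> a' < H \<Longrightarrow> m \<in> marked a' \<Longrightarrow> Side a (edge a' d m) d \<in> nodes"
  unfolding nodes_def edge_def by (cases d) auto

lemma Side_down: "Side (Suc a) b d \<in> nodes \<Longrightarrow> Side a b d \<in> nodes"
  unfolding nodes_def using Suc_leD by blast

lemma Side_lev: "Side a b d \<in> nodes \<Longrightarrow> a \<le> H"
  by (auto simp: nodes_def)

lemma Blk_lev: "Blk a m \<in> nodes \<Longrightarrow> a \<le> H"
  by (auto simp: nodes_def)

lemma Blk_in_nodes: "a < H \<Longrightarrow> m \<in> marked a \<Longrightarrow> Blk a m \<in> nodes"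
  by (auto simp: nodes_def)

definition key :: "nat \<Rightarrow> nat \<times> nat" where "key i = (L i, i)"

definition candidate_range :: "node \<Rightarrow> nat \<Rightarrow> bool \<Rightarrow> nat \<Rightarrow> nat set" where
  "candidate_range v b d m = (if d then {to_copy v b ..< m * len (lev v - 1)}
      else {m * len (lev v - 1) + len (lev v - 1) .. to_copy v b})"

text \<open>
  All records have the same length, a power of 2; hence adding an offset to the low word of a record address never
  overflows.
\<close>

definition rec_size :: nat where "rec_size = 2 ^ (t + 6)"

lemma rec_size_dvd: "W = rec_size * 2 ^ (w - (t + 6))"
  using t_word by (simp add: rec_size_def flip: power_add)

text \<open>A record has entries 0 to \<open>2 * 2 ^ t\<close>, so after 16 header words the last
  entry ends at \<open>24 + 8 * (2 * 2 ^ t)\<close>. The second bound covers all header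
  offsets.\<close>

lemma rec_size_ge: "24 + 8 * (2 * 2 ^ t) \<le> rec_size" "64 \<le> rec_size"
proof -
  have "(2::nat) ^ 1 \<le> 2 ^ t" by (rule power_increasing[OF t_pos]) simp
  then show "24 + 8 * (2 * 2 ^ t) \<le> rec_size" "64 \<le> rec_size"
    by (auto simp: rec_size_def power_add)
qed

end

section \<open>Memory layout of the records\<close>

locale node_layout = shifted_copies +
  fixes ns :: "node list"
  assumes set_ns: "set ns = nodes" and ns_0: "ns ! 0 = Blk H 0"
    and fits: "length ns * rec_size \<le> W * W"
begin

definition idx :: "node \<Rightarrow> nat" where "idx v = (LEAST i. i < length ns \<and> ns ! i = v)"

lemma idx: "v \<in> nodes \<Longrightarrow> idx v < length ns \<and> ns ! idx v = v"
  unfolding idx_def by (rule LeastI_ex) (metis in_set_conv_nth set_ns)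

text \<open>The address registers start out as 0, so the root must be the first record.\<close>

lemma idx_root: "idx (Blk H 0) = 0"
proof -
  have "Blk H 0 \<in> set ns" using set_ns by (simp add: nodes_def)
  then have "0 < length ns" by (rule length_pos_if_in_set)
  then show ?thesis unfolding idx_def using ns_0 by (intro Least_equality) auto
qed

definition ph :: "node \<Rightarrow> nat" where "ph v = idx v * rec_size div W"
definition pl :: "node \<Rightarrow> nat" where "pl v = idx v * rec_size mod W"

text \<open>The record length divides \<open>W\<close>, so no record crosses from one high word to
  the next. This is the third claim, which all later overflow checks use.\<close>

lemma ptr:
  assumes "v \<in> nodes"
  shows "ph v < W" "pl v < W" "pl v + rec_size \<le> W" "ph v * W + pl v = idx v * rec_size"
proof -
  have "idx v * rec_size < length ns * rec_size" using idx[OF assms] rec_size_ge by simp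
  then have "idx v * rec_size < W * W" using fits by linarith
  then show "ph v < W" by (simp add: ph_def less_mult_imp_div_less)
  show "pl v < W" by (simp add: pl_def)
  let ?q = "(2::nat) ^ (w - (t + 6))"
  have "pl v = rec_size * (idx v mod ?q)"
    unfolding pl_def rec_size_dvd by (metis mult.commute mult_mod_right)
  moreover have "Suc (idx v mod ?q) \<le> ?q" by (simp add: Suc_leI)
  then have "rec_size * Suc (idx v mod ?q) \<le> rec_size * ?q" by (rule mult_le_mono2)
  ultimately show "pl v + rec_size \<le> W" unfolding rec_size_dvd by simp
  show "ph v * W + pl v = idx v * rec_size" unfolding ph_def pl_def by (rule div_mult_mod_eq)
qed

text \<open>
  A record starts with 16 words of header, followed by one entry of 8 words for each block around the
  copy. Fields that no query reads (nodes outside the array, children outside \<open>nodes\<close>, empty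
  candidate ranges) contain junk.
\<close>

fun entry :: "node \<Rightarrow> nat \<Rightarrow> nat \<Rightarrow> nat" where
  "entry (Blk a b) m j =
    (if j = 0 then ph (Blk (a - 1) m) else if j = 1 then pl (Blk (a - 1) m)
     else if j = 2 then ph (Side H (m * len (a - 1)) True)
     else if j = 3 then pl (Side H (m * len (a - 1)) True)
     else if j = 4 then ph (Side H (m * len (a - 1) - 1) False)
     else pl (Side H (m * len (a - 1) - 1) False))"
| "entry (Side a b d) m j =
    (if j = 0 then fst (Min (key ` candidate_range (Side a b d) b d m))
     else if j = 1 then snd (Min (key ` candidate_range (Side a b d) b d m))
     else if j = 2 then ph (Side (a - 1) (edge (a - 1) d m) d)
     else pl (Side (a - 1) (edge (a - 1) d m) d))"

fun field :: "node \<Rightarrow> nat \<Rightarrow> nat" where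
  "field (Blk a b) k =
    (if k = 0 then t * (a - 1) else if k = 1 then copy_pos (Blk a b) + W - lo (Blk a b)
     else if k = 2 then copy_add (Blk a b) else if k = 3 then first_block (Blk a b)
     else entry (Blk a b) (first_block (Blk a b) + (k - 16) div 8) ((k - 16) mod 8))"
| "field (Side a b d) k =
    (if k = 0 then b else if k = 1 then (if d then 1 else W - 1) else if k = 2 then L b
     else if k = 3 then t * (a - 1) else if k = 4 then ph (Side (a - 1) b d)
     else if k = 5 then pl (Side (a - 1) b d)
     else if k = 6 then copy_pos (Side a b d) + W - lo (Side a b d)
     else if k = 7 then copy_add (Side a b d) else if k = 8 then first_block (Side a b d)
     else entry (Side a b d) (first_block (Side a b d) + (k - 16) div 8) ((k - 16) mod 8))"

lemma field_entry: "j < 8 \<Longrightarrow> field v (16 + 8 * i + j) = entry v (first_block v + i) j"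
  by (cases v) auto

definition struct :: "nat list" where
  "struct = map (\<lambda>i. field (ns ! (i div rec_size)) (i mod rec_size) mod W) [0..<length ns * rec_size]"

lemma length_struct: "length struct = length ns * rec_size" by (simp add: struct_def)

lemma set_struct: "set struct \<subseteq> {..<W}" by (auto simp: struct_def)

lemma cell:
  assumes "v \<in> nodes" "k < rec_size" "holds_structure struct m"
  shows "m (ph v * W + off (pl v) k) = field v k mod W"
proof -
  have i: "idx v < length ns" "ns ! idx v = v" using idx[OF assms(1)] by auto
  have a: "ph v * W + off (pl v) k = idx v * rec_size + k"
    using ptr(4)[OF assms(1)] by (simp add: off_def)
  have "Suc (idx v) * rec_size \<le> length ns * rec_size" using i by (intro mult_le_mono1) simp
  then have lt: "idx v * rec_size + k < length ns * rec_size" using assms(2) by simp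
  then have "m (idx v * rec_size + k) = struct ! (idx v * rec_size + k)"
    using assms(3) by (simp add: holds_structure_def length_struct)
  also have "\<dots> = field v k mod W" using lt assms(2) i by (simp add: struct_def)
  finally show ?thesis by (simp add: a)
qed

end

section \<open>Correctness of the query program\<close>

lemma word_diff:
  fixes W :: nat
  assumes "x \<le> y" "y - x < W" "x < W"
  shows "(y mod W + W - x) mod W = y - x"
proof -
  have "(y mod W + W - x) mod W = (y mod W + (W - x)) mod W" using assms by simp
  also have "\<dots> = (y + (W - x)) mod W" by (rule mod_add_left_eq)
  also have "y + (W - x) = (y - x) + W" using assms by linarith
  finally show ?thesis using assms(2) by (simp only: mod_add_self2 mod_less)
qed

text \<open>The invariant of a descent: on the interval between \<open>b\<close> and the moving end
  \<open>x\<close>, the map \<open>i + xo - x\<close> leads back to the original array and lowers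
  the values by \<open>K\<close>. Moving to a copy composes the two shifts and leaves the set of
  original positions unchanged.\<close>

lemma translate_frame:
  fixes L :: "nat \<Rightarrow> nat"
  assumes lo: "lo \<le> b" "lo \<le> x" "b \<le> hi" "x \<le> hi"
    and c: "\<forall>i. lo \<le> i \<and> i \<le> hi \<longrightarrow> L (i - lo + u) = L i + s"
    and fr: "\<forall>i. min b x \<le> i \<and> i \<le> max b x \<longrightarrow> x \<le> i + xo \<and> i + xo - x < n \<and> L i = L (i + xo - x) + K"
    and x': "x' = x - lo + u" "b' = b - lo + u"
  shows "\<And>i. min b' x' \<le> i \<Longrightarrow> i \<le> max b' x' \<Longrightarrow>
      x' \<le> i + xo \<and> i + xo - x' < n \<and> L i = L (i + xo - x') + (K + s)"
    and "(\<lambda>i. i + xo - x) ` {min b x..max b x} = (\<lambda>i. i + xo - x') ` {min b' x'..max b' x'}"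
proof -
  have mm: "min b' x' = min b x - lo + u" "max b' x' = max b x - lo + u"
    "lo \<le> min b x" "max b x \<le> hi" "min b x \<le> x" "x \<le> max b x"
    using lo x' by (auto simp: min_def max_def)
  have pre: "\<exists>j. i = j - lo + u \<and> lo \<le> j \<and> j \<le> hi \<and> min b x \<le> j \<and> j \<le> max b x"
    if "min b' x' \<le> i" "i \<le> max b' x'" for i
    using that mm by (intro exI[of _ "i - u + lo"]) linarith
  have o: "j - lo + u + xo - x' = j + xo - x" if "lo \<le> j" for j
    using that lo x' by linarith
  show "x' \<le> i + xo \<and> i + xo - x' < n \<and> L i = L (i + xo - x') + (K + s)"
    if i: "min b' x' \<le> i" "i \<le> max b' x'" for i
  proof -
    obtain j where j: "i = j - lo + u" "lo \<le> j" "j \<le> hi" "min b x \<le> j" "j \<le> max b x"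
      using pre[OF i] by blast
    have f: "x \<le> j + xo" "j + xo - x < n" "L j = L (j + xo - x) + K" using fr j(4,5) by blast+
    have "x' \<le> i + xo" using f(1) j(1,2) lo x' by linarith
    moreover have "i + xo - x' = j + xo - x" unfolding j(1) by (rule o[OF j(2)])
    moreover have "L i = L j + s" unfolding j(1) using c j(2,3) by blast
    ultimately show ?thesis using f(2,3) by simp
  qed
  have "{min b' x'..max b' x'} = (\<lambda>j. j - lo + u) ` {min b x..max b x}"
  proof (intro equalityI subsetI)
    fix i assume "i \<in> {min b' x'..max b' x'}"
    then have "min b' x' \<le> i" "i \<le> max b' x'" unfolding atLeastAtMost_iff by blast+
    from pre[OF this] show "i \<in> (\<lambda>j. j - lo + u) ` {min b x..max b x}"
      unfolding image_iff Bex_def atLeastAtMost_iff by blast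
  next
    fix i assume "i \<in> (\<lambda>j. j - lo + u) ` {min b x..max b x}"
    then obtain j where "i = j - lo + u" "min b x \<le> j" "j \<le> max b x"
      unfolding image_iff Bex_def atLeastAtMost_iff by blast
    then show "i \<in> {min b' x'..max b' x'}" unfolding atLeastAtMost_iff mm(1,2) by linarith
  qed
  then have "(\<lambda>i. i + xo - x') ` {min b' x'..max b' x'} =
      (\<lambda>j. j - lo + u + xo - x') ` {min b x..max b x}" by (simp only: image_image)
  also have "\<dots> = (\<lambda>i. i + xo - x) ` {min b x..max b x}"
    by (rule image_cong[OF refl], rule o) (use mm(3) in \<open>unfold atLeastAtMost_iff, linarith\<close>)
  finally show "(\<lambda>i. i + xo - x) ` {min b x..max b x} = (\<lambda>i. i + xo - x') ` {min b' x'..max b' x'}"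
    by (rule sym)
qed

context node_layout begin

declare field.simps [simp del] entry.simps [simp del]

section \<open>Record lookups and one-sided queries\<close>

lemma W_ge: "64 \<le> W"
proof -
  have "(2::nat) ^ 6 \<le> 2 ^ w" by (rule power_increasing) (use t_word in auto)
  then show ?thesis by simp
qed

text \<open>These are the intermediate results of the address computation, one per instruction. None
  overflows, since the record ends within the range of the low word.\<close>

lemma entry_address:
  assumes v: "v \<in> nodes" "first_block v \<le> mb" "mb < W" "mb - first_block v \<le> 2 * 2 ^ t"
  defines "e \<equiv> pl v + (16 + 8 * (mb - first_block v))"
  shows "first_block v mod W = first_block v"
    "(mb + W - first_block v mod W) mod W = mb - first_block v"
    "((mb - first_block v) * 8) mod W = 8 * (mb - first_block v)"
    "(8 * (mb - first_block v) + 16) mod W = 8 * (mb - first_block v) + 16"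
    "(8 * (mb - first_block v) + 16 + off (pl v) 0) mod W = off e 0"
    "e + 7 < W"
    "\<And>m j. j < 8 \<Longrightarrow> holds_structure struct m \<Longrightarrow> m (ph v * W + off e j) = entry v mb j mod W"
proof -
  let ?i = "mb - first_block v"
  have i: "24 + 8 * ?i \<le> rec_size" using rec_size_ge(1) v(4) by linarith
  note p = ptr(3)[OF v(1)]
  show 1: "first_block v mod W = first_block v" using v by simp
  show "(mb + W - first_block v mod W) mod W = ?i" unfolding 1 using v by (intro word_sub) auto
  show "(?i * 8) mod W = 8 * ?i" using i p by (subst mod_less) auto
  show "(8 * ?i + 16) mod W = 8 * ?i + 16" using i p by (intro mod_less) linarith
  show "(8 * ?i + 16 + off (pl v) 0) mod W = off e 0"
    using i p by (subst mod_less) (auto simp: off_def e_def)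
  show "e + 7 < W" using i p by (simp add: e_def)
  fix m and j :: nat assume "j < 8" "holds_structure struct m"
  moreover have "off e j = off (pl v) (16 + 8 * ?i + j)" by (simp add: off_def e_def)
  ultimately show "m (ph v * W + off e j) = entry v mb j mod W"
    using cell[OF v(1), of "16 + 8 * ?i + j" m] field_entry[of j v ?i] i v(2) by simp
qed

text \<open>If the end is closer to the edge than the next scale, the side of that scale at the same
  edge is followed. Otherwise the stored minimum covers everything from the edge up to the block of
  the end, and the remainder is a side of the next scale at that block. The second case is the more
  expensive one, with 14 + 14 + 11 + 7 = 46 steps per scale.\<close>

lemma Side_correct:
  assumes hm: "holds_structure struct m"
  shows "\<lbrakk>Side a b d \<in> nodes; b < n; x < n; if d then b \<le> x \<and> x < b + len a else x \<le> b \<and> b < x + len a;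
     g 0 = x; g 7 = xo; g 4 = K; g 2 = ph (Side a b d); g 3 = pl (Side a b d); consts_ok g; g 22 = 0;
     xo < n; \<And>i. min b x \<le> i \<Longrightarrow> i \<le> max b x \<Longrightarrow> x \<le> i + xo \<and> i + xo - x < n \<and> L i = L (i + xo - x) + K\<rbrakk>
   \<Longrightarrow> \<exists>k g'. k \<le> 46 * (a + 1) \<and> runs w \<kappa> m k 44 g 97 g' \<and> consts_ok g' \<and>
      (g' 9, g' 10) = min (g 9, g 10) (Min (key ` (\<lambda>i. i + xo - x) ` {min b x..max b x})) \<and>
      (\<forall>i\<in>{1, 8, 18, 19, 20, 21}. g' i = g i)"
proof (induction a arbitrary: b x g K rule: less_induct)
  fix a b x g K
  assume v: "Side a b d \<in> nodes" and bn: "b < n" and xn: "x < n"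
    and dist: "if d then b \<le> x \<and> x < b + len a else x \<le> b \<and> b < x + len a"
    and g: "g 0 = x" "g 7 = xo" "g 4 = K" "g 2 = ph (Side a b d)" "g 3 = pl (Side a b d)" "consts_ok g"
      "g 22 = 0" and xo: "xo < n"
    and fr: "\<And>i. min b x \<le> i \<Longrightarrow> i \<le> max b x \<Longrightarrow> x \<le> i + xo \<and> i + xo - x < n \<and> L i = L (i + xo - x) + K"
    and IH: "\<And>a' b x g K. \<lbrakk>a' < a; Side a' b d \<in> nodes; b < n; x < n;
         if d then b \<le> x \<and> x < b + len a' else x \<le> b \<and> b < x + len a';
       g 0 = x; g 7 = xo; g 4 = K; g 2 = ph (Side a' b d); g 3 = pl (Side a' b d); consts_ok g; g 22 = 0;
       xo < n; \<And>i. min b x \<le> i \<Longrightarrow> i \<le> max b x \<Longrightarrow> x \<le> i + xo \<and> i + xo - x < n \<and> L i = L (i + xo - x) + K\<rbrakk>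
     \<Longrightarrow> \<exists>k g'. k \<le> 46 * (a' + 1) \<and> runs w \<kappa> m k 44 g 97 g' \<and> consts_ok g' \<and>
      (g' 9, g' 10) = min (g 9, g 10) (Min (key ` (\<lambda>i. i + xo - x) ` {min b x..max b x})) \<and>
      (\<forall>i\<in>{1, 8, 18, 19, 20, 21}. g' i = g i)"
  let ?v = "Side a b d"
  let ?goal = "\<exists>k g'. k \<le> 46 * (a + 1) \<and> runs w \<kappa> m k 44 g 97 g' \<and> consts_ok g' \<and>
      (g' 9, g' 10) = min (g 9, g 10) (Min (key ` (\<lambda>i. i + xo - x) ` {min b x..max b x})) \<and>
      (\<forall>i\<in>{1, 8, 18, 19, 20, 21}. g' i = g i)"
  have W: "b < W" "x < W" "xo < W" using bn xn xo n_word by auto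
  have L_x: "L x = L xo + K" using fr[of x] by simp
  have p: "pl ?v + rec_size \<le> W" using ptr[OF v] by simp
  have pk: "pl ?v + k < W" if "k < 64" for k using p that rec_size_ge(2) by linarith
  define c where "c = (\<lambda>k. m (ph ?v * W + off (pl ?v) k))"
  have c: "c k = field ?v k mod W" if "k < 64" for k
    unfolding c_def by (rule cell[OF v _ hm]) (use that rec_size_ge(2) in linarith)
  define z where "z = (if d then x - b else b - x)"
  have z: "(((g 0 + W - c 0) mod W) * c 1) mod W = z"
  proof -
    have c01: "c 0 = b" "c 1 = (if d then 1 else W - 1)" using c[of 0] c[of 1] W W_ge by (auto simp: field.simps)
    show ?thesis
    proof (cases "d \<or> x = b")
      case True
      then show ?thesis using c01 g(1) word_sub[of b x W] W dist by (auto simp: z_def)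
    next
      case False
      then have c1: "c 1 = W - 1" and zz: "z = b - x" and xb: "x < b"
        using c01(2) dist by (auto simp: z_def)
      show ?thesis unfolding g(1) c01(1) c1 zz by (rule word_neg_mult[OF xb W(1)])
    qed
  qed
  obtain g1 where g1: "runs w \<kappa> m 9 44 g (if z = 0 then 88 else 53) g1"
     "consts_ok g1" "g1 13 = z" "g1 14 = c 2" "g1 15 = g 7" "g1 12 = off (pl ?v) 2"
     "\<And>i. i \<notin> {12, 13, 14, 15} \<Longrightarrow> g1 i = g i"
    using prog_side[of g "pl ?v" w "ph ?v" m c _ z \<kappa>] g pk[of 2] z by (auto simp: c_def off_def)
  show ?goal
  proof (cases "z = 0")
    case True
    then have xb: "x = b" using dist by (auto simp: z_def split: if_splits)
    obtain g2 where g2: "runs w \<kappa> m 1 88 g1 89 g2" "consts_ok g2" "g2 22 = 1"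
      "\<And>i. i \<noteq> 22 \<Longrightarrow> g2 i = g1 i"
      using prog_side_base[OF g1(2)] by blast
    have "c 2 = L b" using c[of 2] L_less[OF bn] n_word by (simp add: field.simps)
    then have v2: "(g2 14 + W - g2 4) mod W = L xo"
      using g2(4) g1 g L_x xb L_less[OF bn] n_word word_sub[of K "L b" W] by simp
    obtain k g3 where g3: "k \<le> 7" "runs w \<kappa> m k 89 g2 97 g3" "consts_ok g3"
      "(g3 9, g3 10) = min (g2 9, g2 10) (L xo, g2 15)" "\<And>i. i \<notin> {9, 10, 14} \<Longrightarrow> g3 i = g2 i"
      using prog_compare[OF g2(2) v2, of \<kappa> m] g2(3) by auto
    have "runs w \<kappa> m (9 + 1 + k) 44 g 97 g3"
      using runs_trans[OF runs_trans[OF g1(1)[unfolded True, simplified] g2(1)] g3(2)] by simp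
    moreover have "(g3 9, g3 10) = min (g 9, g 10) (Min (key ` (\<lambda>i. i + xo - x) ` {min b x..max b x}))"
      using g3(4) g2(4) g1 g xb by (simp add: key_def)
    moreover have "\<forall>i\<in>{1, 8, 18, 19, 20, 21}. g3 i = g i" using g3(5) g2(4) g1(7) by auto
    moreover have "9 + 1 + k \<le> 46 * (a + 1)" using g3(1) by simp
    ultimately show ?thesis using g3(3) by blast
  next
    case False
    \<comment> \<open>A side of scale 0 is a single point, where the distance would be 0.\<close>
    have "a \<noteq> 0" using dist False by (auto simp: z_def split: if_splits intro!: Nat.gr0I)
    then obtain a' where a: "a = Suc a'" by (cases a) auto
    then have aa: "a' < a" by simp
    have aH: "a \<le> H" using Side_lev[OF v] .
    have "t * a' \<le> t * H" using aH a by simp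
    then have ta: "t * a' < W" using tH_word by linarith
    have c3: "c 3 = t * a'" using c[of 3] ta a by (simp add: field.simps)
    have zdiv: "g1 13 div 2 ^ c 3 = z div len a'" by (simp add: g1(3) c3 len_def)
    obtain g2 where g2: "runs w \<kappa> m 5 53 g1 (if z div len a' = 0 then 83 else 58) g2"
      "consts_ok g2" "g2 12 = off (pl ?v) 4" "g2 11 = t * a'" "\<And>i. i \<notin> {11, 12, 13} \<Longrightarrow> g2 i = g1 i"
      using prog_side_level[of g1 "pl ?v" w "ph ?v" m c "z div len a'" \<kappa>] g1 pk[of 4] zdiv g c3
      by (auto simp: c_def)
    have g2': "g2 i = g i" if "i \<notin> {11, 12, 13, 14, 15}" for i using g1(7) g2(5) that by simp
    have r2: "runs w \<kappa> m 14 44 g (if z div len a' = 0 then 83 else 58) g2"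
      using runs_trans[OF g1(1)[simplified False, simplified] g2(1)] by simp
    show ?thesis
    proof (cases "z < len a'")
      case True
      have vd: "Side a' b d \<in> nodes" using Side_down v a by simp
      obtain g3 where g3: "runs w \<kappa> m 5 83 g2 44 g3" "consts_ok g3" "g3 2 = c 4" "g3 3 = c 5"
        "\<And>i. i \<notin> {2, 3, 12, 13} \<Longrightarrow> g3 i = g2 i"
        using prog_side_down[of g2 "pl ?v" w "ph ?v" c m \<kappa>] g2(2,3) pk[of 5] g2'[of 2] g
        by (auto simp: c_def)
      have c45: "c 4 = ph (Side a' b d)" "c 5 = pl (Side a' b d)"
        using c[of 4] c[of 5] a ptr[OF vd] by (auto simp: field.simps)
      have g3': "g3 i = g i" if "i \<notin> {2, 3, 11, 12, 13, 14, 15}" for i using g2' g3(5) that by simp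
      have d': "if d then b \<le> x \<and> x < b + len a' else x \<le> b \<and> b < x + len a'"
        using dist True by (auto simp: z_def split: if_splits)
      have pr: "g3 0 = x" "g3 7 = xo" "g3 4 = K" "g3 2 = ph (Side a' b d)" "g3 3 = pl (Side a' b d)" "g3 22 = 0"
        using g3'[of 0] g3'[of 7] g3'[of 4] g3'[of 22] g3(3,4) c45 g by auto
      obtain k g4 where g4: "k \<le> 46 * (a' + 1)" "runs w \<kappa> m k 44 g3 97 g4" "consts_ok g4"
        "(g4 9, g4 10) = min (g3 9, g3 10) (Min (key ` (\<lambda>i. i + xo - x) ` {min b x..max b x}))"
        "\<forall>i\<in>{1, 8, 18, 19, 20, 21}. g4 i = g3 i"
        using IH[OF aa vd bn xn d' pr(1-5) g3(2) pr(6) xo fr] by blast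
      have "runs w \<kappa> m (14 + 5 + k) 44 g 97 g4"
        using runs_trans[OF runs_trans[OF r2[simplified True div_less, simplified] g3(1)] g4(2)] True
        by simp
      moreover have "14 + 5 + k \<le> 46 * (a + 1)" using g4(1) a by simp
      moreover have "\<forall>i\<in>{1, 8, 18, 19, 20, 21}. g4 i = g i" using g4(5) g3' by auto
      moreover have "(g4 9, g4 10) = min (g 9, g 10) (Min (key ` (\<lambda>i. i + xo - x) ` {min b x..max b x}))"
        using g4(4) g3'[of 9] g3'[of 10] by simp
      ultimately show ?thesis using g4(3) by blast
    next
      case zge: False
      have lv: "lev ?v = Suc a'" by (simp add: a)
      have lb: "lo ?v \<le> b" "b \<le> hi ?v" "lo ?v \<le> x" "x \<le> hi ?v" "hi ?v < n"
        using dist bn xn len_pos[of a] by (auto split: if_splits)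
      define x' where "x' = to_copy ?v x"
      define b' where "b' = to_copy ?v b"
      define K' where "K' = K + copy_add ?v"
      have x': "x' < n" "L x' = L x + copy_add ?v" "b' < n" "L b' = L b + copy_add ?v"
        using to_copy[OF lb(3-5)] to_copy[OF lb(1,2,5)] by (auto simp: x'_def b'_def)
      have K': "K' < W" "copy_add ?v < W" using L_less[OF x'(1)] x'(2) L_x n_word by (auto simp: K'_def)
      define mb where "mb = x' div len a'"
      have mb: "first_block ?v \<le> mb" "mb - first_block ?v \<le> 2 * 2 ^ t" "mb \<in> marked a'"
        using block_range[OF lv lb(3-5)] by (auto simp: mb_def x'_def)
      have "mb \<le> x'" unfolding mb_def by (rule div_le_dividend)
      then have mbW: "mb < W" using x'(1) n_word by linarith
      note ea = entry_address[OF v mb(1) mbW mb(2)]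
      define e where "e = pl ?v + (16 + 8 * (mb - first_block ?v))"
      have c678: "c 6 = (copy_pos ?v + W - lo ?v) mod W" "c 7 = copy_add ?v"
        "c 8 = first_block ?v mod W"
        using c[of 6] c[of 7] c[of 8] K' by (auto simp: field.simps)
      have xs: "(g2 0 + c 6) mod W = x'" "x' div 2 ^ g2 11 = mb"
        using to_copy(3)[OF lb(3-5)] c678(1) g2'[of 0] g2(4) g(1)
        by (auto simp: x'_def mb_def len_def)
      obtain g3 where g3: "runs w \<kappa> m 14 58 g2 72 g3" "consts_ok g3" "g3 0 = x'"
         "g3 4 = (g2 4 + c 7) mod W" "g3 12 = off e 0" "\<And>i. i \<notin> {0, 4, 12, 13, 16} \<Longrightarrow> g3 i = g2 i"
        using prog_side_shift[of g2 "pl ?v" w "ph ?v" m c x' mb "mb - first_block ?v"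
            "8 * (mb - first_block ?v)" "8 * (mb - first_block ?v) + 16" "off e 0" \<kappa>]
          g2(2,3) pk[of 8] g2'[of 2] g2'[of 3] g c678(3) ea(2-5)[folded e_def] xs
        by (auto simp: c_def off_def)
      have "g2 4 = K" using g2'[of 4] g(3) by simp
      then have g34: "g3 4 = K'" using g3(4) c678(2) K'(1) by (simp only: K'_def mod_less)
      have g3': "g3 i = g i" if "i \<notin> {0, 4, 11, 12, 13, 14, 15, 16}" for i using g2' g3(6) that by simp
      let ?c = "Side a' (edge a' d mb) d"
      have vc: "?c \<in> nodes" using Side_in_nodes[of a' a' mb d] aH a mb by simp
      define C where "C = candidate_range ?v b d mb"
      obtain cv cq where cvq: "Min (key ` C) = (cv, cq)" by force
      let ?b = "edge a' d mb"
      have mbx: "mb * len a' \<le> x'" "x' < mb * len a' + len a'"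
        by (simp_all add: mb_def dividend_less_div_times add.commute[of _ "len a'"])
      have bx: "if d then x' = b' + z else b' = x' + z"
      proof -
        define l0 where "l0 = lo ?v"
        have "l0 \<le> b" "l0 \<le> x" "x' = x - l0 + copy_pos ?v" "b' = b - l0 + copy_pos ?v"
          using lb unfolding x'_def b'_def to_copy_def l0_def by blast+
        then show ?thesis using dist by (cases d) (auto simp: z_def)
      qed
      have C: "C = (if d then {b' ..< mb * len a'} else {mb * len a' + len a' .. b'})"
        by (simp add: C_def candidate_range_def a b'_def)
      \<comment> \<open>A distance of at least \<open>len a'\<close> puts the copy of the edge
        outside the block of \<open>x'\<close>, so the stored minimum ranges over a nonempty
        set.\<close>
      have Cne: "finite C" "C \<noteq> {}" using C bx mbx zge by (auto split: if_splits)
      have b2: "?b < n" "if d then ?b \<le> x' \<and> x' < ?b + len a' else x' \<le> ?b \<and> ?b < x' + len a'"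
        using bx mbx zge x' len_pos[of a'] by (auto simp: edge_def split: if_splits)
      have tcp: "\<forall>i. lo ?v \<le> i \<and> i \<le> hi ?v \<longrightarrow> L (i - lo ?v + copy_pos ?v) = L i + copy_add ?v"
        using to_copy(2)[OF _ _ lb(5)] unfolding to_copy_def by blast
      have frA: "\<forall>i. min b x \<le> i \<and> i \<le> max b x \<longrightarrow>
          x \<le> i + xo \<and> i + xo - x < n \<and> L i = L (i + xo - x) + K"
        using fr by blast
      note tf = translate_frame[OF lb(1,3,2,4) tcp frA x'_def[unfolded to_copy_def]
          b'_def[unfolded to_copy_def], folded K'_def]
      note fr' = tf(1) and im = tf(2)
      have un: "{min b' x'..max b' x'} = C \<union> {min ?b x'..max ?b x'}"
      proof (cases d)
        case True
        then have "min b' x' = b'" "max b' x' = x'" "min ?b x' = ?b" "max ?b x' = x'" "b' \<le> ?b" "?b \<le> x'"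
          using bx b2 zge mbx by (auto simp: edge_def)
        then show ?thesis using C True by (auto simp: edge_def)
      next
        case False
        then have "min b' x' = x'" "max b' x' = b'" "min ?b x' = x'" "max ?b x' = ?b" "?b \<le> b'" "x' \<le> ?b"
          using bx b2 zge mbx by (auto simp: edge_def)
        then show ?thesis using C False len_pos[of a'] by (auto simp: edge_def simp del: len_pos)
      qed
      have CU: "min b' x' \<le> i" "i \<le> max b' x'" if "i \<in> C \<or> i \<in> {min ?b x'..max ?b x'}" for i
      proof -
        have "i \<in> {min b' x'..max b' x'}" unfolding un using that by blast
        then show "min b' x' \<le> i" "i \<le> max b' x'" unfolding atLeastAtMost_iff by blast+
      qed
      have "\<And>i. i \<in> C \<Longrightarrow> x' \<le> i + xo \<and> L i = L (i + xo - x') + K'" using CU fr' by blast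
      note mt = Min_key_translate[OF Cne, of L cv cq x' xo K', folded key_def, OF cvq this]
      have cq: "min b' x' \<le> cq" "cq \<le> max b' x'" using CU mt(1) by blast+
      have cqn: "cq < n" using cq x' by (auto simp: max_def split: if_splits)
      obtain g4 where g4: "runs w \<kappa> m 11 72 g3 89 g4" "consts_ok g4" "g4 14 = cv"
         "g4 15 = ((cq + xo) mod W + W - x') mod W" "g4 2 = ph ?c" "g4 3 = pl ?c"
         "\<And>i. i \<notin> {2, 3, 12, 13, 14, 15} \<Longrightarrow> g4 i = g3 i"
      proof -
        have e3: "e + 3 < W" using ea(6) by (simp add: e_def)
        have en: "m (g3 2 * W + off e j) = entry ?v mb j mod W" if "j < 8" for j
          using ea(7)[OF that hm] g3'[of 2] g by (simp add: e_def)
        have "cv < W" "cq < W" using mt(2) L_less[OF cqn] cqn n_word by auto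
        then have "m (g3 2 * W + off e 0) = cv" "m (g3 2 * W + off e 1) = cq"
          "m (g3 2 * W + off e 2) = ph ?c" "m (g3 2 * W + off e 3) = pl ?c"
          using en[of 0] en[of 1] en[of 2] en[of 3] cvq ptr[OF vc] by (auto simp: a C_def entry.simps)
        then show ?thesis
          using prog_side_entry[of g3 e w "\<lambda>k. m (g3 2 * W + off e k)" m \<kappa>] g3(2,5) e3 that g3(3) g3'[of 7] g
          by auto
      qed
      \<comment> \<open>The intermediate sum \<open>cq + xo\<close> may leave the word range; only
        the difference is known to fit.\<close>
      have q4: "g4 15 = cq + xo - x'"
      proof -
        have "x' \<le> cq + xo" "cq + xo - x' < W" using fr'[OF cq] n_word by auto
        then show ?thesis unfolding g4(4) using x'(1) n_word by (intro word_diff) auto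
      qed
      have v4: "(g4 14 + W - g4 4) mod W = cv - K'"
      proof -
        have k4: "g4 4 = K'" using g4(7)[of 4] g34 by simp
        have "K' \<le> cv" "cv < W" using fr'[OF cq] mt(2) L_less[OF cqn] n_word by auto
        then show ?thesis unfolding g4(3) k4 by (rule word_sub)
      qed
      obtain k5 g5 where g5: "k5 \<le> 7" "runs w \<kappa> m k5 89 g4 44 g5" "consts_ok g5"
        "(g5 9, g5 10) = min (g4 9, g4 10) (cv - K', g4 15)" "\<And>i. i \<notin> {9, 10, 14} \<Longrightarrow> g5 i = g4 i"
        using prog_compare[OF g4(2) v4, of \<kappa> m] g4(7)[of 22] g3'[of 22] g by auto
      have g5': "g5 i = g i" if "i \<notin> {0, 2, 3, 4, 9, 10, 11, 12, 13, 14, 15, 16}" for i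
        using g5(5) g4(7) g3' that by simp
      have g5m: "(g5 9, g5 10) = min (g 9, g 10) (Min (key ` (\<lambda>i. i + xo - x') ` C))"
        using g5(4) g4(7) g3' q4 mt(3) by simp
      have f5: "x' \<le> i + xo \<and> i + xo - x' < n \<and> L i = L (i + xo - x') + K'"
        if "min ?b x' \<le> i" "i \<le> max ?b x'" for i
        by (rule fr'; rule CU; use that in simp)
      have pr: "g5 0 = x'" "g5 7 = xo" "g5 4 = K'" "g5 2 = ph ?c" "g5 3 = pl ?c" "g5 22 = 0"
        using g5(5)[of 0] g5(5)[of 4] g5(5)[of 2] g5(5)[of 3] g4(5,6) g4(7)[of 0] g4(7)[of 4]
          g3(3) g34 g5'[of 7] g5'[of 22] g by auto
      obtain k g6 where g6: "k \<le> 46 * (a' + 1)" "runs w \<kappa> m k 44 g5 97 g6" "consts_ok g6"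
        "(g6 9, g6 10) = min (g5 9, g5 10) (Min (key ` (\<lambda>i. i + xo - x') ` {min ?b x'..max ?b x'}))"
        "\<forall>i\<in>{1, 8, 18, 19, 20, 21}. g6 i = g5 i"
        using IH[OF aa vc b2(1) x'(1) b2(2) pr(1-5) g5(3) pr(6) xo f5] by blast
      have "Min (key ` (\<lambda>i. i + xo - x') ` C \<union> key ` (\<lambda>i. i + xo - x') ` {min ?b x'..max ?b x'})
         = min (Min (key ` (\<lambda>i. i + xo - x') ` C))
              (Min (key ` (\<lambda>i. i + xo - x') ` {min ?b x'..max ?b x'}))"
        using Cne by (intro Min_Un) auto
      then have "(g6 9, g6 10) = min (g 9, g 10) (Min (key ` (\<lambda>i. i + xo - x) ` {min b x..max b x}))"
        unfolding im un image_Un g6(4) g5m by (simp only: min.assoc)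
      moreover have "runs w \<kappa> m (14 + 14 + 11 + k5 + k) 44 g 97 g6"
      proof -
        have "z div len a' \<noteq> 0" using zge len_pos[of a'] by (simp add: div_eq_0_iff del: len_pos)
        then have "runs w \<kappa> m 14 44 g 58 g2" using r2 by (simp only: if_False)
        from runs_trans[OF runs_trans[OF runs_trans[OF runs_trans[OF this g3(1)] g4(1)] g5(2)] g6(2)]
        show ?thesis .
      qed
      moreover have "14 + 14 + 11 + k5 + k \<le> 46 * (a + 1)" using g6(1) g5(1) a by simp
      moreover have "\<forall>i\<in>{1, 8, 18, 19, 20, 21}. g6 i = g i" using g6(5) g5' by auto
      ultimately show ?thesis using g6(3) by blast
    qed
  qed
qed

section \<open>Splitting a query at a block edge\<close>

definition framed :: "nat \<Rightarrow> nat \<Rightarrow> nat \<Rightarrow> nat \<Rightarrow> bool" where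
  "framed y x xo K \<longleftrightarrow> (\<forall>i. min y x \<le> i \<and> i \<le> max y x \<longrightarrow>
     x \<le> i + xo \<and> i + xo - x < n \<and> L i = L (i + xo - x) + K)"

text \<open>Two distinct ends cannot share a block of length 1, so the descent reaches a scale where
  their blocks differ. A common block costs 17 + 5 = 22 steps, the final split 17 + 11 = 28. Both
  sides start at scale \<open>H\<close> whatever the scale of the split, so the entry needs one
  pointer per direction.\<close>

lemma Blk_correct:
  assumes hm: "holds_structure struct m"
  shows "\<lbrakk>Blk a b \<in> nodes; b * len a \<le> x; x < y; y < b * len a + len a; y < n;
     g 0 = x; g 1 = y; g 4 = K; g 2 = ph (Blk a b); g 3 = pl (Blk a b); consts_ok g; framed y x xo K\<rbrakk>
   \<Longrightarrow> \<exists>k g' A x' y' K'. k \<le> 22 * a + 28 \<and> runs w \<kappa> m k 11 g 44 g' \<and> consts_ok g' \<and>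
      g' 0 = x' \<and> g' 1 = y' \<and> g' 4 = K' \<and> g' 18 = K' \<and> x' < A \<and> A \<le> y' \<and> y' < n \<and> y' + x = y + x' \<and>
      Side H (A - 1) False \<in> nodes \<and> Side H A True \<in> nodes \<and>
      g' 2 = ph (Side H (A - 1) False) \<and> g' 3 = pl (Side H (A - 1) False) \<and>
      g' 19 = ph (Side H A True) \<and> g' 20 = pl (Side H A True) \<and> framed y' x' xo K' \<and>
      (\<forall>i\<in>{7, 8, 9, 10, 21, 22}. g' i = g i)"
proof (induction a arbitrary: b x y g K rule: less_induct)
  case (less a b x y g K)
  note v = less.prems(1) and ord = less.prems(2-5) and g = less.prems(6-11) and fr = less.prems(12)
  let ?v = "Blk a b"
  have "a \<noteq> 0" using ord by (auto intro!: Nat.gr0I)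
  then obtain a' where a: "a = Suc a'" by (cases a) auto
  then have aa: "a' < a" by simp
  have aH: "a \<le> H" using Blk_lev[OF v] .
  have W: "x < W" "y < W" using ord n_word by auto
  have p: "pl ?v + rec_size \<le> W" using ptr[OF v] by simp
  have pk: "pl ?v + k < W" if "k < 64" for k using p that rec_size_ge(2) by linarith
  define c where "c = (\<lambda>k. m (ph ?v * W + off (pl ?v) k))"
  have c: "c k = field ?v k mod W" if "k < 64" for k
    unfolding c_def by (rule cell[OF v _ hm]) (use that rec_size_ge(2) in linarith)
  have lv: "lev ?v = Suc a'" by (simp add: a)
  have lb: "lo ?v \<le> x" "x \<le> hi ?v" "lo ?v \<le> y" "y \<le> hi ?v" "hi ?v < n"
    using ord by auto
  define x' where "x' = to_copy ?v x"
  define y' where "y' = to_copy ?v y"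
  define K' where "K' = K + copy_add ?v"
  have x': "x' < n" "y' < n" using to_copy(1)[OF lb(1,2,5)] to_copy(1)[OF lb(3-5)] by (simp_all only: x'_def y'_def)
  have xy: "x' < y'" "y' + x = y + x'"
  proof -
    define l0 where "l0 = lo ?v"
    have "l0 \<le> x" "l0 \<le> y" "x' = x - l0 + copy_pos ?v" "y' = y - l0 + copy_pos ?v"
      using lb unfolding x'_def y'_def to_copy_def l0_def by blast+
    then show "x' < y'" "y' + x = y + x'" using ord(2) by linarith+
  qed
  have tcp: "\<forall>i. lo ?v \<le> i \<and> i \<le> hi ?v \<longrightarrow> L (i - lo ?v + copy_pos ?v) = L i + copy_add ?v"
    using to_copy(2)[OF _ _ lb(5)] unfolding to_copy_def by blast
  have fr': "framed y' x' xo K'" unfolding framed_def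
    using translate_frame(1)[OF lb(3,1,4,2) tcp fr[unfolded framed_def] x'_def[unfolded to_copy_def]
          y'_def[unfolded to_copy_def], folded K'_def] by blast
  have K': "K' < W" "copy_add ?v < W"
  proof -
    have "min y' x' \<le> x' \<and> x' \<le> max y' x'" by simp
    then have "L x' = L (x' + xo - x') + K'" using fr' unfolding framed_def by blast
    then show "K' < W" "copy_add ?v < W" using L_less[OF x'(1)] n_word by (auto simp: K'_def)
  qed
  have "t * a' \<le> t * H" using aH a by simp
  then have ta: "t * a' < W" using tH_word by linarith
  have cs: "c 0 = t * a'" "c 1 = (copy_pos ?v + W - lo ?v) mod W" "c 2 = copy_add ?v"
    "c 3 = first_block ?v mod W"
    using c[of 0] c[of 1] c[of 2] c[of 3] ta a K' by (auto simp: field.simps)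
  define mx where "mx = x' div len a'"
  define my where "my = y' div len a'"
  have mb: "first_block ?v \<le> mx" "first_block ?v \<le> my" "my - first_block ?v \<le> 2 * 2 ^ t"
     "\<And>m'. first_block ?v \<le> m' \<Longrightarrow> m' \<le> my \<Longrightarrow> m' \<in> marked a'"
    using block_range[OF lv lb(1,2,5)] block_range[OF lv lb(3-5)] by (auto simp: mx_def my_def x'_def y'_def)
  have mxy: "mx \<le> my" unfolding mx_def my_def using xy by (intro div_le_mono) simp
  have "my \<le> y'" unfolding my_def by (rule div_le_dividend)
  then have myW: "my < W" using x'(2) n_word by linarith
  note ea = entry_address[OF v mb(2) myW mb(3)]
  define e where "e = pl ?v + (16 + 8 * (my - first_block ?v))"
  have xs: "(g 0 + c 1) mod W = x'" "(g 1 + c 1) mod W = y'" "x' div 2 ^ c 0 = mx" "y' div 2 ^ c 0 = my"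
    unfolding g(1,2) cs x'_def y'_def
    by (rule to_copy(3)[OF lb(1,2,5)], rule to_copy(3)[OF lb(3-5)],
        simp_all add: mx_def my_def x'_def y'_def len_def)
  obtain g1 where g1: "runs w \<kappa> m 17 11 g (if mx < my then 33 else 28) g1" "consts_ok g1"
    "g1 0 = x'" "g1 1 = y'" "g1 4 = (g 4 + c 2) mod W" "g1 14 = off e 0"
    "\<And>i. i \<notin> {0, 1, 4, 11, 12, 13, 14, 16, 17} \<Longrightarrow> g1 i = g i"
    using prog_block[of g "pl ?v" w "ph ?v" m c x' y' mx my "my - first_block ?v"
        "8 * (my - first_block ?v)" "8 * (my - first_block ?v) + 16" "off e 0" \<kappa>]
      g pk[of 3] ea(2-5)[folded e_def] xs cs(4)
    by (auto simp: c_def off_def)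
  have g14: "g1 4 = K'" using g1(5) cs(3) K'(1) g(3) by (simp only: K'_def mod_less)
  have en: "m (g1 2 * W + off e j) = entry ?v my j mod W" if "j < 8" for j
    using ea(7)[OF that hm] g1(7)[of 2] g by (simp add: e_def)
  have e7: "e + 7 < W" using ea(6) by (simp add: e_def)
  have myy: "my * len a' \<le> y'" "y' < my * len a' + len a'" "x' < mx * len a' + len a'" "mx * len a' \<le> x'"
    by (simp_all add: my_def mx_def dividend_less_div_times add.commute[of _ "len a'"])
  show ?case
  proof (cases "mx < my")
    case False
    then have eq: "mx = my" using mxy by simp
    have vc: "Blk a' my \<in> nodes" using Blk_in_nodes[of a' my] mb(2,4) aH a by simp
    have cc: "m (g1 2 * W + off e 0) = ph (Blk a' my)" "m (g1 2 * W + off e 1) = pl (Blk a' my)"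
      using en[of 0] en[of 1] ptr[OF vc] a by (auto simp: entry.simps)
    obtain g2 where g2: "runs w \<kappa> m 5 28 g1 11 g2" "consts_ok g2" "g2 2 = ph (Blk a' my)"
       "g2 3 = pl (Blk a' my)" "\<And>i. i \<notin> {2, 3, 14, 19} \<Longrightarrow> g2 i = g1 i"
      using prog_block_descend[of g1 e w "\<lambda>k. m (g1 2 * W + off e k)" m \<kappa>] g1(2,6) e7 cc by auto
    have pr: "my * len a' \<le> x'" "y' < my * len a' + len a'" "g2 0 = x'" "g2 1 = y'" "g2 4 = K'"
      using myy eq g2(5)[of 0] g2(5)[of 1] g2(5)[of 4] g1(3,4) g14 by auto
    obtain k g' A x'' y'' K'' where I: "k \<le> 22 * a' + 28" "runs w \<kappa> m k 11 g2 44 g'" "consts_ok g'"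
      "g' 0 = x''" "g' 1 = y''" "g' 4 = K''" "g' 18 = K''" "x'' < A" "A \<le> y''" "y'' < n" "y'' + x' = y' + x''"
      "Side H (A - 1) False \<in> nodes" "Side H A True \<in> nodes"
      "g' 2 = ph (Side H (A - 1) False)" "g' 3 = pl (Side H (A - 1) False)"
      "g' 19 = ph (Side H A True)" "g' 20 = pl (Side H A True)" "framed y'' x'' xo K''"
      "\<forall>i\<in>{7, 8, 9, 10, 21, 22}. g' i = g2 i"
      using less.IH[OF aa vc pr(1) xy(1) pr(2) x'(2) pr(3-5) g2(3,4,2) fr'] by blast
    have "runs w \<kappa> m 17 11 g 28 g1" using g1(1) False by (simp only: if_False)
    from runs_trans[OF runs_trans[OF this g2(1)] I(2)]
    have "runs w \<kappa> m (17 + 5 + k) 11 g 44 g'" .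
    moreover have "17 + 5 + k \<le> 22 * a + 28" using I(1) a by simp
    moreover have "y'' + x = y + x''" using I(11) xy(2) by linarith
    moreover have "\<forall>i\<in>{7, 8, 9, 10, 21, 22}. g' i = g i" using I(19) g2(5) g1(7) by auto
    ultimately show ?thesis using I(3-10,12-18) by blast
  next
    case True
    \<comment> \<open>The cut is the left edge of the block of the right end. Then
      \<open>A - 1\<close> is the right edge of block \<open>my - 1\<close>, which is marked because
      \<open>mx < my\<close> keeps it at or above \<open>first_block\<close>.\<close>
    define A where "A = my * len a'"
    have "mx + 1 \<le> my" using True by simp
    then have "(mx + 1) * len a' \<le> A" unfolding A_def by (rule mult_le_mono1)
    then have A: "x' < A" "A \<le> y'" using myy by (auto simp: A_def)
    have v2: "Side H A True \<in> nodes"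
      using Side_in_nodes[of H a' my True] mb(2,4) aH a by (simp add: edge_def A_def)
    have m1: "my - 1 \<in> marked a'" using mb True by auto
    obtain q where q: "my = Suc q" using True by (cases my) auto
    have v1: "Side H (A - 1) False \<in> nodes"
      using Side_in_nodes[of H a' "my - 1" False] m1 aH a
      by (simp add: edge_def A_def q add.commute)
    have cc: "m (g1 2 * W + off e 2) = ph (Side H A True)" "m (g1 2 * W + off e 3) = pl (Side H A True)"
      "m (g1 2 * W + off e 4) = ph (Side H (A - 1) False)" "m (g1 2 * W + off e 5) = pl (Side H (A - 1) False)"
      using en[of 2] en[of 3] en[of 4] en[of 5] ptr[OF v1] ptr[OF v2] a
      by (auto simp: entry.simps A_def)
    obtain g2 where g2: "runs w \<kappa> m 11 33 g1 44 g2" "consts_ok g2"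
       "g2 19 = ph (Side H A True)" "g2 20 = pl (Side H A True)"
       "g2 2 = ph (Side H (A - 1) False)" "g2 3 = pl (Side H (A - 1) False)" "g2 18 = g1 4"
       "\<And>i. i \<notin> {2, 3, 13, 14, 18, 19, 20} \<Longrightarrow> g2 i = g1 i"
      using prog_block_split[of g1 e w "\<lambda>k. m (g1 2 * W + off e k)" m \<kappa>] g1(2,6) e7 cc by auto
    have "runs w \<kappa> m 17 11 g 33 g1" using g1(1) True by (simp only: if_True)
    from runs_trans[OF this g2(1)] have "runs w \<kappa> m (17 + 11) 11 g 44 g2" .
    moreover have "17 + 11 \<le> 22 * a + 28" by simp
    moreover have "g2 0 = x'" "g2 1 = y'" "g2 4 = K'" "g2 18 = K'"
      using g2(8)[of 0] g2(8)[of 1] g2(8)[of 4] g2(7) g1(3,4) g14 by auto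
    moreover have "\<forall>i\<in>{7, 8, 9, 10, 21, 22}. g2 i = g i" using g2(8) g1(7) by auto
    ultimately show ?thesis using g2(2-6) A x'(2) xy(2) v1 v2 fr' by blast
  qed
qed

text \<open>A single-element query is answered at once, since the split requires distinct ends. In
  the other case the phases take at most 11 + (22 \<open>H\<close> + 28) + 46 (\<open>H\<close> + 1)
  + 9 + 46 (\<open>H\<close> + 1) + 3 steps, which 150 (\<open>H\<close> + 1) rounds up.\<close>

lemma query_correct:
  assumes hm: "holds_structure struct m" and be: "b < e" "e \<le> n"
    and \<kappa>: "2 ^ \<kappa> mod 2 ^ w \<noteq> (0::nat)"
  shows "\<exists>k g. k \<le> 150 * (H + 1) \<and>
     runs w \<kappa> m k 0 ((\<lambda>_. 0)(0 := b mod W, 1 := e mod W)) 111 g \<and>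
     g 0 = Suc (snd (Min (key ` {b..<e}))) mod W"
proof (cases "b = e - 1")
  case True
  then have "{b..<e} = {b}" "Suc b = e" using be by auto
  then have s: "Suc (snd (Min (key ` {b..<e}))) = e" by (simp add: key_def)
  obtain g where "runs w \<kappa> m 11 0 ((\<lambda>_. 0)(0 := b mod W, 1 := e mod W)) 111 g" "g 0 = e mod W"
    using prog_single[OF \<kappa>, of e b m] W_ge be n_word True by auto
  moreover have "11 \<le> 150 * (H + 1)" by simp
  ultimately show ?thesis unfolding s by blast
next
  case False
  have lenH: "n \<le> len H" using n_le by (simp add: len_def)
  have bW: "b < W" "1 \<le> e" "e \<le> W" "16 < W" using be n_word W_ge by auto
  obtain g0 where g0: "runs w \<kappa> m 11 0 ((\<lambda>_. 0)(0 := b mod W, 1 := e mod W)) 11 g0" "consts_ok g0"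
    "g0 0 = b" "g0 7 = b" "g0 1 = e - 1" "g0 8 = e - 1" "g0 9 = W - 1" "g0 10 = W - 1"
    "g0 2 = 0" "g0 3 = 0" "g0 4 = 0" "g0 21 = 0" "g0 22 = 0"
    using prog_init[OF \<kappa> bW(4,2,3,1) False, of m] by blast
  have root: "Blk H 0 \<in> nodes" "g0 2 = ph (Blk H 0)" "g0 3 = pl (Blk H 0)"
    using g0 idx_root by (auto simp: nodes_def ph_def pl_def)
  have fr0: "framed (e - 1) b b 0" using be by (auto simp: framed_def)
  have r0: "0 * len H \<le> b" "b < e - 1" "e - 1 < 0 * len H + len H" "e - 1 < n"
    using be False lenH by auto
  obtain k1 g1 A x' y' K' where g1: "k1 \<le> 22 * H + 28" "runs w \<kappa> m k1 11 g0 44 g1" "consts_ok g1"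
      "g1 0 = x'" "g1 1 = y'" "g1 4 = K'" "g1 18 = K'" "x' < A" "A \<le> y'" "y' < n" "y' + b = e - 1 + x'"
      "Side H (A - 1) False \<in> nodes" "Side H A True \<in> nodes"
      "g1 2 = ph (Side H (A - 1) False)" "g1 3 = pl (Side H (A - 1) False)"
      "g1 19 = ph (Side H A True)" "g1 20 = pl (Side H A True)" "framed y' x' b K'"
      "\<forall>i\<in>{7, 8, 9, 10, 21, 22}. g1 i = g0 i"
    using Blk_correct[OF hm root(1) r0 g0(3,5,11) root(2,3) g0(2) fr0, of \<kappa>] by blast
  have fr: "x' \<le> i + b \<and> i + b - x' < n \<and> L i = L (i + b - x') + K'" if "x' \<le> i" "i \<le> y'" for i
    using g1(18) that g1(8,9) unfolding framed_def by auto
  have p1: "A - 1 < n" "x' < n" "if False then A - 1 \<le> x' \<and> x' < A - 1 + len H else x' \<le> A - 1 \<and> A - 1 < x' + len H"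
    "g1 7 = b" "g1 22 = 0" "b < n"
    using g1(8-10) lenH g1(19) g0 be by auto
  have fr1: "x' \<le> i + b \<and> i + b - x' < n \<and> L i = L (i + b - x') + K'"
    if "min (A - 1) x' \<le> i" "i \<le> max (A - 1) x'" for i
    using fr[of i] that g1(8,9) by simp
  obtain k2 g2 where g2: "k2 \<le> 46 * (H + 1)" "runs w \<kappa> m k2 44 g1 97 g2" "consts_ok g2"
      "(g2 9, g2 10) = min (g1 9, g1 10) (Min (key ` (\<lambda>i. i + b - x') ` {min (A - 1) x'..max (A - 1) x'}))"
      "\<forall>i\<in>{1, 8, 18, 19, 20, 21}. g2 i = g1 i"
    using Side_correct[OF hm g1(12) p1(1-3) g1(4) p1(4) g1(6) g1(14,15,3) p1(5,6) fr1, of \<kappa>] by blast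
  have "g2 21 = 0" using g2(5) g1(19) g0(12) by simp
  then obtain g3 where g3: "runs w \<kappa> m 9 97 g2 44 g3" "consts_ok g3" "g3 21 = 1" "g3 22 = 0" "g3 0 = g2 1"
    "g3 7 = g2 8" "g3 2 = g2 19" "g3 3 = g2 20" "g3 4 = g2 18"
    "\<And>i. i \<notin> {21, 22, 0, 7, 2, 3, 4} \<Longrightarrow> g3 i = g2 i"
    using prog_next_side[OF g2(3), of w \<kappa> m] by blast
  have p3: "A < n" "y' < n" "if True then A \<le> y' \<and> y' < A + len H else y' \<le> A \<and> A < y' + len H"
    "g3 0 = y'" "g3 7 = e - 1" "g3 4 = K'" "g3 2 = ph (Side H A True)" "g3 3 = pl (Side H A True)" "e - 1 < n"
    using g1(8-10) lenH g3(5-9) g2(5) g1(5,7,16,17,19) g0(6) be by auto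
  \<comment> \<open>Both ends were moved by the same amount, so the right side translates back by
    the same map although it refers to the other end.\<close>
  have tr: "i + (e - 1) - y' = i + b - x'" for i using g1(11) by linarith
  have fr3: "y' \<le> i + (e - 1) \<and> i + (e - 1) - y' < n \<and> L i = L (i + (e - 1) - y') + K'"
    if "min A y' \<le> i" "i \<le> max A y'" for i
  proof -
    have i: "x' \<le> i" "i \<le> y'" using that g1(8,9) by auto
    have "y' \<le> i + (e - 1)" using fr[OF i] g1(11) by linarith
    then show ?thesis unfolding tr using fr[OF i] by blast
  qed
  obtain k4 g4 where g4: "k4 \<le> 46 * (H + 1)" "runs w \<kappa> m k4 44 g3 97 g4" "consts_ok g4"
      "(g4 9, g4 10) = min (g3 9, g3 10) (Min (key ` (\<lambda>i. i + (e - 1) - y') ` {min A y'..max A y'}))"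
      "\<forall>i\<in>{1, 8, 18, 19, 20, 21}. g4 i = g3 i"
    using Side_correct[OF hm g1(13) p3(1-8) g3(2,4) p3(9) fr3, of \<kappa>] by blast
  have "g4 21 = 1" using g4(5) g3(3) by simp
  then obtain g5 where g5: "runs w \<kappa> m 3 97 g4 111 g5" "g5 0 = (g4 10 + 1) mod W"
    using prog_finish[OF g4(3), of w \<kappa> m] by blast
  have mm: "min (A - 1) x' = x'" "max (A - 1) x' = A - 1" "min A y' = A" "max A y' = y'"
    using g1(8,9) by auto
  let ?f = "\<lambda>i. i + b - x'"
  have un: "?f ` {x'..A - 1} \<union> ?f ` {A..y'} = {b..<e}"
  proof -
    have "?f ` {x'..A - 1} \<union> ?f ` {A..y'} = ?f ` {x'..y'}"
      unfolding image_Un[symmetric] using g1(8,9) by (intro arg_cong[of _ _ "\<lambda>S. ?f ` S"]) auto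
    also have "\<dots> = {b..<e}"
    proof (intro equalityI subsetI)
      fix j assume "j \<in> {b..<e}"
      then show "j \<in> ?f ` {x'..y'}" using g1(11) by (intro image_eqI[of _ _ "j - b + x'"]) auto
    qed (use g1(11) be in auto)
    finally show ?thesis .
  qed
  have fin: "finite (key ` ?f ` {x'..A - 1})" "key ` ?f ` {x'..A - 1} \<noteq> {}"
    "finite (key ` ?f ` {A..y'})" "key ` ?f ` {A..y'} \<noteq> {}" using g1(8,9) by auto
  define M where "M = Min (key ` {b..<e})"
  have M: "M = min (Min (key ` ?f ` {x'..A - 1})) (Min (key ` ?f ` {A..y'}))"
    unfolding M_def un[symmetric] image_Un using fin by (intro Min_Un) auto
  have "M \<in> key ` {b..<e}" unfolding M_def using be by (intro Min_in) auto
  then obtain q where q: "M = (L q, q)" "q < e" by (auto simp: key_def)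
  \<comment> \<open>Values and positions are below \<open>n\<close>, so the initial pair of largest
    words never beats a genuine candidate.\<close>
  have "L q \<le> W - 1" "q \<le> W - 1" using L_less[of q] q be n_word by auto
  then have le: "M \<le> (W - 1, W - 1)" unfolding q by (simp add: less_eq_prod_def)
  have "(g4 9, g4 10) = min (W - 1, W - 1) M"
  proof -
    have "(g1 9, g1 10) = (W - 1, W - 1)" "(g3 9, g3 10) = (g2 9, g2 10)"
      using g1(19) g0 g3(10) by auto
    then show ?thesis unfolding g4(4) tr mm M using g2(4)[unfolded mm] by (simp only: min.assoc)
  qed
  then have "(g4 9, g4 10) = M" using le by (simp only: min_absorb2)
  then have "g5 0 = Suc (snd M) mod W" unfolding g5(2) by (metis Suc_eq_plus1 snd_conv)
  moreover from runs_trans[OF runs_trans[OF runs_trans[OF runs_trans[OF runs_trans[OF g0(1) g1(2)] g2(2)] g3(1)] g4(2)] g5(1)]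
  have "runs w \<kappa> m (11 + k1 + k2 + 9 + k4 + 3) 0 ((\<lambda>_. 0)(0 := b mod W, 1 := e mod W)) 111 g5" .
  moreover have "11 + k1 + k2 + 9 + k4 + 3 \<le> 150 * (H + 1)" using g1(1) g2(1) g4(1) by simp
  ultimately show ?thesis unfolding M_def by blast
qed

end

section \<open>Counting the nodes\<close>

context shifted_copies begin

text \<open>A marked block is given by its scale, an element of \<open>R\<close> and an offset of at
  most \<open>2 * 2 ^ t\<close>, hence by one of \<open>b\<close> triples. Each triple accounts for
  one block and for two sides on each of \<open>H\<close> + 1 scales, at most
  \<open>6 * H * b\<close> nodes including the root. With
  \<open>2 * 2 ^ t + 1 \<le> 3 * 2 ^ t\<close> and \<open>64 * 2 ^ t\<close> words per record the
  constant is 3 * 6 * 64 = 1152.\<close>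

lemma finite_card_nodes:
  assumes fin: "finite R" and H: "1 \<le> H"
  shows "finite nodes" "card nodes * rec_size \<le> 1152 * card R * (2 ^ t) ^ 2 * H ^ 2"
proof -
  let ?B = "{..<H} \<times> R \<times> {..2 * (2::nat) ^ t}"
  define pos where "pos = (\<lambda>(a, p, i). p div len a - 2 ^ t + i)"
  have mk: "\<exists>z\<in>?B. fst z = a \<and> pos z = m" if am: "a < H" "m \<in> marked a" for a m
  proof -
    obtain p where p: "p \<in> R" "p div len a - 2 ^ t \<le> m" "m \<le> p div len a + 2 ^ t"
      using am(2) by (auto simp: marked_def)
    have "m - (p div len a - 2 ^ t) \<le> 2 * 2 ^ t" using p(3) by linarith
    then show ?thesis using p am(1)
      by (intro bexI[of _ "(a, p, m - (p div len a - 2 ^ t))"]) (auto simp: pos_def)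
  qed
  define N1 where "N1 = (\<lambda>z. Blk (fst z) (pos z)) ` ?B"
  define N2 where "N2 = (\<lambda>(a, z). Side a (pos z * len (fst z)) True) ` ({..H} \<times> ?B)"
  define N3 where "N3 = (\<lambda>(a, z). Side a (pos z * len (fst z) + len (fst z) - 1) False) ` ({..H} \<times> ?B)"
  have "nodes \<subseteq> insert (Blk H 0) (N1 \<union> (N2 \<union> N3))"
  proof
    fix v assume "v \<in> nodes"
    then consider "v = Blk H 0" | a m where "v = Blk a m" "a < H" "m \<in> marked a"
      | a a' m where "v = Side a (m * len a') True" "a \<le> H" "a' < H" "m \<in> marked a'"
      | a a' m where "v = Side a (m * len a' + len a' - 1) False" "a \<le> H" "a' < H" "m \<in> marked a'"
      unfolding nodes_def by blast
    then show "v \<in> insert (Blk H 0) (N1 \<union> (N2 \<union> N3))"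
    proof cases
      case 1 then show ?thesis by simp
    next
      case (2 a m)
      then obtain z where "z \<in> ?B" "fst z = a" "pos z = m" using mk[of a m] by blast
      then have "v \<in> N1" unfolding N1_def using 2 by (intro image_eqI[of _ _ z]) auto
      then show ?thesis by simp
    next
      case (3 a a' m)
      then obtain z where "z \<in> ?B" "fst z = a'" "pos z = m" using mk[of a' m] by blast
      then have "v \<in> N2" unfolding N2_def using 3 by (intro image_eqI[of _ _ "(a, z)"]) auto
      then show ?thesis by simp
    next
      case (4 a a' m)
      then obtain z where "z \<in> ?B" "fst z = a'" "pos z = m" using mk[of a' m] by blast
      then have "v \<in> N3" unfolding N3_def using 4 by (intro image_eqI[of _ _ "(a, z)"]) auto
      then show ?thesis by simp
    qed
  qed
  moreover have finN: "finite N1" "finite N2" "finite N3" using fin by (auto simp: N1_def N2_def N3_def)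
  ultimately show "finite nodes" by (meson finite_UnI finite.insertI finite_subset)
  define b where "b = card ?B"
  have finB: "finite ?B" using fin by simp
  have c1: "card N1 \<le> b" unfolding N1_def b_def using finB by (rule card_image_le)
  have c2: "card N2 \<le> (H + 1) * b"
    using card_image_le[of "{..H} \<times> ?B"] finB by (simp add: N2_def b_def card_cartesian_product)
  have c3: "card N3 \<le> (H + 1) * b"
    using card_image_le[of "{..H} \<times> ?B"] finB by (simp add: N3_def b_def card_cartesian_product)
  have "card nodes \<le> card (insert (Blk H 0) (N1 \<union> (N2 \<union> N3)))"
    using \<open>nodes \<subseteq> _\<close> finN by (intro card_mono) auto
  also have "\<dots> \<le> Suc (card (N1 \<union> (N2 \<union> N3)))" by (rule card_insert_le_m1) (auto simp: card_insert_if)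
  also have "card (N1 \<union> (N2 \<union> N3)) \<le> card N1 + (card N2 + card N3)"
    by (meson add_left_mono card_Un_le order_trans)
  finally have cn: "card nodes \<le> 1 + b + 2 * ((H + 1) * b)" using c1 c2 c3 by linarith
  have "R \<noteq> {}" using copy[of 0 0] n_pos by auto
  then have "1 \<le> card R" using fin by (simp add: Suc_le_eq card_gt_0_iff)
  have b: "b = H * (card R * (2 * 2 ^ t + 1))" by (simp add: b_def card_cartesian_product)
  have "1 \<le> b" using H \<open>1 \<le> card R\<close> by (simp add: b)
  then have "1 + b + 2 * ((H + 1) * b) \<le> b * (2 * H + 4)" by (simp add: algebra_simps)
  also have "\<dots> \<le> b * (6 * H)" using H by (intro mult_le_mono2) linarith
  also have "\<dots> \<le> H * (card R * (3 * 2 ^ t)) * (6 * H)"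
    unfolding b by (intro mult_le_mono1 mult_le_mono2) simp
  finally have "card nodes \<le> H * (card R * (3 * 2 ^ t)) * (6 * H)" using cn by linarith
  then have "card nodes * rec_size \<le> H * (card R * (3 * 2 ^ t)) * (6 * H) * rec_size"
    by (rule mult_le_mono1)
  also have "\<dots> = 1152 * card R * (2 ^ t) ^ 2 * H ^ 2"
    by (simp add: rec_size_def power_add power2_eq_square)
  finally show "card nodes * rec_size \<le> 1152 * card R * (2 ^ t) ^ 2 * H ^ 2" .
qed

lemma node_layout_exists:
  assumes "finite R" "1 \<le> H" "card nodes * rec_size \<le> W * W"
  shows "\<exists>ns. node_layout n L R t H w ns \<and> length ns = card nodes"
proof -
  have fin: "finite nodes" using finite_card_nodes(1) assms by blast
  obtain xs where xs: "set xs = nodes - {Blk H 0}" "distinct xs"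
    using finite_distinct_list[of "nodes - {Blk H 0}"] fin by blast
  have root: "Blk H 0 \<in> nodes" by (simp add: nodes_def)
  have "length xs = card (nodes - {Blk H 0})" using distinct_card[OF xs(2)] xs(1) by simp
  then have len: "length (Blk H 0 # xs) = card nodes"
    using card_Suc_Diff1[OF fin root] by simp
  have "node_layout n L R t H w (Blk H 0 # xs)"
    by unfold_locales (use xs root len assms(3) in \<open>auto\<close>)
  then show ?thesis using len by blast
qed

end

section \<open>Size and time bounds\<close>

lemma answers_queryI:
  assumes "\<And>m. range m \<subseteq> {..<2 ^ w} \<Longrightarrow> holds_structure D m \<Longrightarrow>
    \<exists>k g. real k \<le> time \<and> runs w \<kappa> m k 0 ((\<lambda>_. 0)(0 := x mod 2 ^ w, 1 := y mod 2 ^ w)) 111 g \<and>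
      g 0 = ans mod 2 ^ w"
  shows "answers_query w (prog \<kappa>) D time x y ans"
  unfolding answers_query_def
proof (intro allI impI)
  fix m assume m: "range m \<subseteq> {..<2 ^ w} \<and> holds_structure D m"
  obtain k g where g: "real k \<le> time" "runs w \<kappa> m k 0 ((\<lambda>_. 0)(0 := x mod 2 ^ w, 1 := y mod 2 ^ w)) 111 g"
      "g 0 = ans mod 2 ^ w" using assms m by blast
  show "\<exists>k s. real k \<le> time \<and> s = (step w (prog \<kappa>) ^^ k) (query_state w x y m) \<and>
          halted (prog \<kappa>) s \<and> regs s 0 = ans mod 2 ^ w \<and> holds_structure D (mem s)"
    using g m by (intro exI[of _ k] exI[of _ "\<lparr>pc = 111, regs = g, mem = m\<rparr>"])
      (auto simp: runs_def query_state_def halted_def)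
qed

text \<open>The two argument registers directly form a two-word address. A low word 0 is decoded as
  the right end \<open>2 ^ w\<close>, which is unambiguous because a right end is at least
  1.\<close>

lemma table_answers:
  assumes w: "2 ^ \<kappa> mod 2 ^ w = (0::nat)" and n: "length T \<le> 2 ^ w" and time: "3 \<le> time"
  shows "\<exists>D. set D \<subseteq> {..<2 ^ w} \<and> length D = 2 ^ w * 2 ^ w \<and>
    (\<forall>b e. b < e \<and> e \<le> length T \<longrightarrow> answers_query w (prog \<kappa>) D time b e (LCP_argmin T b e))"
proof -
  let ?W = "(2::nat) ^ w"
  define f where "f = (\<lambda>i. LCP_argmin T (i div ?W) (if i mod ?W = 0 then ?W else i mod ?W) mod ?W)"
  define D where "D = map f [0..<?W * ?W]"
  have "answers_query w (prog \<kappa>) D time b e (LCP_argmin T b e)" if be: "b < e" "e \<le> length T" for b e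
  proof (rule answers_queryI)
    fix m assume m: "holds_structure D m"
    let ?g = "(\<lambda>_. 0::nat)(0 := b mod ?W, 1 := e mod ?W)"
    have bW: "b < ?W" "e \<le> ?W" using be n by auto
    have "Suc b * ?W \<le> ?W * ?W" using bW(1) by (intro mult_le_mono1) simp
    moreover have "e mod ?W < ?W" by simp
    ultimately have lt: "b * ?W + e mod ?W < ?W * ?W"
      unfolding mult_Suc by linarith
    have "(if e mod ?W = 0 then ?W else e mod ?W) = e"
    proof (cases "e = ?W")
      case False
      then have "e < ?W" using bW by simp
      then show ?thesis using be by simp
    qed simp
    moreover have "(b * ?W + e mod ?W) div ?W = b" "(b * ?W + e mod ?W) mod ?W = e mod ?W" by simp_all
    ultimately have "f (b * ?W + e mod ?W) = LCP_argmin T b e mod ?W" by (simp only: f_def)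
    then have "m (b * ?W + e mod ?W) = LCP_argmin T b e mod ?W"
      using m lt by (simp add: holds_structure_def D_def)
    then show "\<exists>k g. real k \<le> time \<and> runs w \<kappa> m k 0 ?g 111 g \<and> g 0 = LCP_argmin T b e mod ?W"
      using prog_table[OF w, of ?g m] time bW(1) by (intro exI[of _ 3]) auto
  qed
  moreover have "set D \<subseteq> {..<?W}" "length D = ?W * ?W" by (auto simp: D_def f_def)
  ultimately show ?thesis by blast
qed

section \<open>Numerical estimates and choice of the scales\<close>

lemma quartic_le_power_of_2: "41 \<le> w \<Longrightarrow> 18432 * w ^ 4 \<le> (2::nat) ^ w"
proof (induction w rule: nat_induct_at_least)
  case base show ?case by simp
next
  case (Suc w)
  have "Suc w ^ 4 \<le> 2 * w ^ 4"
  proof -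
    have "real (Suc w) ^ 4 \<le> 2 * real w ^ 4"
    proof -
      have "real (Suc w) \<le> 42 / 41 * real w" using Suc(1) by simp
      then have "real (Suc w) ^ 4 \<le> (42 / 41 * real w) ^ 4" by (rule power_mono) simp
      also have "\<dots> = (42 / 41) ^ 4 * real w ^ 4" by (rule power_mult_distrib)
      also have "\<dots> \<le> 2 * real w ^ 4" by (intro mult_right_mono) (auto simp: power4_eq_xxxx)
      finally show ?thesis .
    qed
    then have "real (Suc w ^ 4) \<le> real (2 * w ^ 4)" by simp
    then show ?thesis by (simp only: of_nat_le_iff)
  qed
  then show ?case using Suc by simp
qed

lemma lg_ge_2: "2 \<le> lg n"
proof -
  have "2 powr 2 \<le> max 4 (real n)" by simp
  then show ?thesis unfolding lg_def by (subst le_log_iff) auto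
qed

text \<open>The tangent of \<open>ln\<close> at 2 gives \<open>ln x \<le> x / 2 - 1 + ln 2\<close>;
  the rest is 1/2 \<le> \<open>ln 2\<close> \<le> 1.\<close>

lemma log_2_le_self:
  assumes "0 < (x::real)" shows "log 2 x \<le> x"
proof -
  have "ln (x / 2) \<le> x / 2 - 1" using ln_le_minus_one[of "x / 2"] assms by simp
  moreover have "ln (x / 2) = ln x - ln 2" using assms by (simp add: ln_div)
  moreover have "1 / 2 \<le> ln (2::real)" by (metis exp_half_le2 ln_ge_iff zero_less_numeral)
  then have "x * (1 / 2) \<le> x * ln 2" using assms by (intro mult_left_mono) auto
  moreover have "ln (2::real) \<le> 1" using ln_le_minus_one[of 2] by simp
  ultimately have "ln x \<le> x * ln 2" by linarith
  then show ?thesis by (simp add: log_def field_simps)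
qed

text \<open>Rounding \<open>t\<close> down keeps \<open>2 ^ t\<close> below
  \<open>lg n powr (\<epsilon> / 2)\<close>, except when \<open>t\<close> is raised to 1, which the
  factor 2 covers. Rounding down a number that is at least 1 loses at most half of it, so
  \<open>t\<close> is at least \<epsilon>/4 times the iterated logarithm; this bounds
  \<open>H\<close> for the running time. For the size the cruder bound \<open>2 * lg n\<close> is
  enough.\<close>

lemma level_parameters:
  fixes \<epsilon> :: real
  assumes eps: "0 < \<epsilon>" "\<epsilon> < 1"
  obtains t H :: nat where "1 \<le> t" "1 \<le> H" "n \<le> 2 ^ (t * H)"
    "2 ^ t \<le> 2 * lg n powr (\<epsilon> / 2)" "real H \<le> 2 * lg n" "real (t * H) \<le> lg n + real t"
    "real H + 1 \<le> (4 / \<epsilon> + 2) * (lg n / log 2 (lg n))"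
proof -
  define l where "l = lg n"
  define ll where "ll = log 2 l"
  have l2: "2 \<le> l" unfolding l_def by (rule lg_ge_2)
  have ll1: "1 \<le> ll" unfolding ll_def using l2 by (subst le_log_iff) auto
  have lll: "ll \<le> l" unfolding ll_def using l2 by (intro log_2_le_self) simp
  define t where "t = max 1 (nat \<lfloor>\<epsilon> / 2 * ll\<rfloor>)"
  define H where "H = nat \<lceil>l / real t\<rceil>"
  have t1: "1 \<le> t" by (simp add: t_def)
  have tpow: "2 ^ t \<le> 2 * l powr (\<epsilon> / 2)"
  proof (cases "t = 1")
    case True
    have "1 \<le> l powr (\<epsilon> / 2)" using l2 eps by (intro ge_one_powr_ge_zero) auto
    then show ?thesis using True by simp
  next
    case False
    then have "t = nat \<lfloor>\<epsilon> / 2 * ll\<rfloor>" by (auto simp: t_def max_def split: if_splits)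
    moreover have "0 \<le> \<epsilon> / 2 * ll" using eps ll1 by simp
    ultimately have "real t \<le> \<epsilon> / 2 * ll" by (simp only: of_nat_floor)
    then have "2 powr real t \<le> 2 powr (\<epsilon> / 2 * ll)" by simp
    also have "\<dots> = (2 powr ll) powr (\<epsilon> / 2)" by (simp add: powr_powr mult.commute)
    also have "2 powr ll = l" unfolding ll_def using l2 by simp
    finally have "2 ^ t \<le> l powr (\<epsilon> / 2)" by (simp add: powr_realpow)
    then show ?thesis using powr_ge_zero[of l "\<epsilon> / 2"] by linarith
  qed
  have tge: "\<epsilon> / 4 * ll \<le> real t"
  proof (cases "\<epsilon> / 2 * ll < 1")
    case True
    then show ?thesis using t1 by linarith
  next
    case False
    have "\<epsilon> / 2 * ll < real_of_int \<lfloor>\<epsilon> / 2 * ll\<rfloor> + 1" by linarith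
    moreover have "1 \<le> \<lfloor>\<epsilon> / 2 * ll\<rfloor>" using False by simp
    moreover have "real_of_int \<lfloor>\<epsilon> / 2 * ll\<rfloor> \<le> real t" using calculation(2) by (simp add: t_def)
    ultimately show ?thesis by linarith
  qed
  have Hc: "l / real t \<le> real H" "real H \<le> l / real t + 1"
    using l2 t1 by (auto simp: H_def of_nat_ceiling)
  have "0 < l / real t" using l2 t1 by simp
  then have H1: "1 \<le> H" using Hc(1) by linarith
  have tH: "l \<le> real (t * H)" using Hc(1) t1 by (simp add: field_simps)
  have "real n \<le> 2 powr l" unfolding l_def lg_def by simp
  also have "\<dots> \<le> 2 powr real (t * H)" using tH by simp
  also have "\<dots> = real (2 ^ (t * H))"
    by (simp only: of_nat_power of_nat_numeral) (rule powr_realpow, simp)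
  finally have nle: "n \<le> 2 ^ (t * H)" by (simp only: of_nat_le_iff)
  have "l / real t \<le> l" using l2 t1 by (simp add: field_simps mult_le_cancel_left1)
  then have H2: "real H \<le> 2 * l" using Hc(2) l2 by linarith
  have tH2: "real (t * H) \<le> l + real t" using Hc(2) t1 by (simp add: field_simps)
  have "l / real t \<le> l / (\<epsilon> / 4 * ll)" using tge eps ll1 l2 t1
    by (intro divide_left_mono mult_pos_pos) auto
  also have "\<dots> = 4 / \<epsilon> * (l / ll)" using eps ll1 by (simp add: field_simps)
  finally have "real H + 1 \<le> 4 / \<epsilon> * (l / ll) + 2" using Hc(2) by linarith
  moreover have "1 \<le> l / ll" using lll ll1 by simp
  ultimately have "real H + 1 \<le> (4 / \<epsilon> + 2) * (l / ll)" unfolding distrib_right by linarith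
  then show ?thesis using that[OF t1 H1 nle] tpow H2 tH2 unfolding l_def ll_def by blast
qed

text \<open>The size constant combines 1152 from the node count, 3 from \<open>card_breaks\<close>,
  and 4 from each of the squares of \<open>2 ^ t\<close> and \<open>H\<close>: 1152 * 3 * 16 =
  55296.\<close>

lemma structure_exists:
  fixes \<epsilon> :: real and T :: "'a::linorder list"
  assumes eps: "0 < \<epsilon>" "\<epsilon> < 1" and T: "T \<noteq> []" and n: "length T \<le> 2 ^ w" and w: "41 \<le> w"
    and \<kappa>: "2 ^ \<kappa> mod 2 ^ w \<noteq> (0::nat)"
    and time: "150 * (4 / \<epsilon> + 2) * (lg (length T) / log 2 (lg (length T))) \<le> time"
  shows "\<exists>D. set D \<subseteq> {..<2 ^ w} \<and>
    real (length D) \<le> 55296 * (real (bwt_runs T) * lg (length T) powr (2 + \<epsilon>)) \<and>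
    (\<forall>b e. b < e \<and> e \<le> length T \<longrightarrow> answers_query w (prog \<kappa>) D time b e (LCP_argmin T b e))"
proof -
  let ?n = "length T"
  define l where "l = lg ?n"
  obtain t H :: nat where tH: "1 \<le> t" "1 \<le> H" "?n \<le> 2 ^ (t * H)"
    "2 ^ t \<le> 2 * l powr (\<epsilon> / 2)" "real H \<le> 2 * l" "real (t * H) \<le> l + real t"
    "real H + 1 \<le> (4 / \<epsilon> + 2) * (l / log 2 l)"
    using level_parameters[OF eps, of ?n] unfolding l_def by blast
  have l2: "2 \<le> l" unfolding l_def by (rule lg_ge_2)
  have lw: "l \<le> real w"
  proof -
    have "max 4 (real ?n) \<le> 2 powr real w"
    proof -
      have "(2::real) ^ 2 \<le> 2 ^ w" using w by (intro power_increasing) auto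
      moreover have "real ?n \<le> real (2 ^ w)" using n by (simp only: of_nat_le_iff)
      ultimately show ?thesis by (simp add: powr_realpow)
    qed
    then show ?thesis unfolding l_def lg_def by (simp add: log_le_iff)
  qed
  \<comment> \<open>With \<open>2 ^ t\<close> and \<open>H\<close> both at most
    \<open>2 * w\<close>, the node count contributes 1152 * 2 ^ 4 = 18432 as the factor of
    \<open>w ^ 4\<close>. The same inequality yields the weaker word-size conditions on
    \<open>t\<close> and \<open>t * H\<close>.\<close>
  have quart: "18432 * w ^ 4 \<le> (2::nat) ^ w" using quartic_le_power_of_2[OF w] .
  have w1: "w ^ 1 \<le> w ^ 4" using w by (intro power_increasing) auto
  have "l powr (\<epsilon> / 2) \<le> l powr 1" using l2 eps by (intro powr_mono) auto
  then have tl: "2 ^ t \<le> 2 * l" using tH(4) l2 by simp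
  then have "2 ^ t \<le> 2 * real w" using lw by linarith
  then have "real (2 ^ t) \<le> real (2 * w)" by simp
  then have tw: "2 ^ t \<le> 2 * w" by (simp only: of_nat_le_iff)
  have "2 ^ (t + 6) \<le> (2::nat) ^ w" using tw quart w1 by (simp add: power_add)
  then have t6: "t + 6 \<le> w" by simp
  have "real (t * H) \<le> real (2 * w)" using tH(6) lw t6 by simp
  then have "t * H \<le> 2 * w" by (simp only: of_nat_le_iff)
  then have tHW: "t * H < 2 ^ w" using quart w1 w by simp
  interpret shifted_copies ?n "lcp0 T" "breaks T" t H w
    by unfold_locales (use T lcp0_less interval_copy_at_break tH n t6 tHW in auto)
  have fin: "finite (breaks T)" by (simp add: breaks_def)
  have cR: "card (breaks T) \<le> ?n"
    using card_mono[of "{..<?n}" "breaks T"] by (auto simp: breaks_def)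
  note cn = finite_card_nodes[OF fin tH(2)]
  have Hw: "H \<le> 2 * w"
  proof -
    have "real H \<le> real (2 * w)" using tH(5) lw by simp
    then show ?thesis by (simp only: of_nat_le_iff)
  qed
  have "1152 * card (breaks T) * (2 ^ t) ^ 2 * H ^ 2 \<le> 1152 * 2 ^ w * (2 * w) ^ 2 * (2 * w) ^ 2"
    using cR n tw Hw by (intro mult_le_mono power_mono) auto
  also have "\<dots> = 2 ^ w * (18432 * w ^ 4)" by (simp add: power2_eq_square power4_eq_xxxx)
  also have "\<dots> \<le> 2 ^ w * 2 ^ w" using quart by (rule mult_le_mono2)
  finally have fit: "card nodes * rec_size \<le> 2 ^ w * 2 ^ w" using cn(2) by linarith
  obtain ns where ns: "node_layout ?n (lcp0 T) (breaks T) t H w ns" "length ns = card nodes"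
    using node_layout_exists[OF fin tH(2) fit] by blast
  interpret node_layout ?n "lcp0 T" "breaks T" t H w ns by (rule ns(1))
  have "answers_query w (prog \<kappa>) struct time b e (LCP_argmin T b e)" if be: "b < e" "e \<le> ?n" for b e
  proof (rule answers_queryI)
    fix m assume m: "holds_structure struct m"
    obtain k g where g: "k \<le> 150 * (H + 1)"
      "runs w \<kappa> m k 0 ((\<lambda>_. 0)(0 := b mod 2 ^ w, 1 := e mod 2 ^ w)) 111 g"
      "g 0 = Suc (snd (Min (key ` {b..<e}))) mod 2 ^ w"
      using query_correct[OF m be \<kappa>] by blast
    obtain v q where vq: "Min (key ` {b..<e}) = (v, q)" by force
    have "Suc (snd (Min (key ` {b..<e}))) = LCP_argmin T b e"
      using LCP_argmin_eq[OF be(1), of T v q] vq by (simp add: key_def)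
    moreover have "real k \<le> time"
    proof -
      have "real k \<le> real (150 * (H + 1))" using g(1) by (simp only: of_nat_le_iff)
      also have "\<dots> = 150 * (real H + 1)" by simp
      also have "\<dots> \<le> 150 * ((4 / \<epsilon> + 2) * (l / log 2 l))" using tH(7) by simp
      also have "\<dots> \<le> time" using time unfolding l_def by (simp only: mult.assoc)
      finally show ?thesis .
    qed
    ultimately show "\<exists>k g. real k \<le> time \<and>
        runs w \<kappa> m k 0 ((\<lambda>_. 0)(0 := b mod 2 ^ w, 1 := e mod 2 ^ w)) 111 g \<and>
        g 0 = LCP_argmin T b e mod 2 ^ w" using g by metis
  qed
  moreover have "real (length struct) \<le> 55296 * (real (bwt_runs T) * l powr (2 + \<epsilon>))"
  proof -
    have "length struct \<le> 1152 * card (breaks T) * (2 ^ t) ^ 2 * H ^ 2"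
      using cn(2) by (simp add: length_struct ns(2))
    also have "\<dots> \<le> 1152 * (3 * bwt_runs T) * (2 ^ t) ^ 2 * H ^ 2"
      using card_breaks[OF T] by (intro mult_le_mono1 mult_le_mono2)
    finally have "real (length struct) \<le> real (1152 * (3 * bwt_runs T) * (2 ^ t) ^ 2 * H ^ 2)"
      by (simp only: of_nat_le_iff)
    also have "\<dots> = 3456 * real (bwt_runs T) * ((2 ^ t) ^ 2 * real H ^ 2)" by simp
    also have "\<dots> \<le> 3456 * real (bwt_runs T) * ((2 * l powr (\<epsilon> / 2)) ^ 2 * (2 * l) ^ 2)"
      using tH(4,5) l2 by (intro mult_left_mono mult_mono power_mono) auto
    also have "(2 * l powr (\<epsilon> / 2)) ^ 2 * (2 * l) ^ 2 = 16 * l powr (2 + \<epsilon>)"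
    proof -
      have "(l powr (\<epsilon> / 2)) ^ 2 = l powr \<epsilon>" by (simp add: power2_eq_square flip: powr_add)
      moreover have "l ^ 2 = l powr 2" using l2 by (simp add: powr_numeral)
      ultimately show ?thesis by (simp add: power_mult_distrib powr_add)
    qed
    finally show ?thesis by simp
  qed
  ultimately show ?thesis using set_struct unfolding l_def by blast
qed

theorem theoremB8:
  fixes \<epsilon> :: real
  assumes "0 < \<epsilon>" and "\<epsilon> < 1"
  shows "\<exists>(P :: ram_program) (C :: real).
    \<forall>(T :: 'a::linorder list) (w :: nat). T \<noteq> [] \<and> log 2 (real (length T)) \<le> real w \<longrightarrow>
      (\<exists>D :: nat list. set D \<subseteq> {..<2 ^ w} \<and>
         real (length D) \<le> C * (real (bwt_runs T) * lg (length T) powr (2 + \<epsilon>)) \<and>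
         (\<forall>b e. b < e \<and> e \<le> length T \<longrightarrow>
            answers_query w P D (C * (lg (length T) / log 2 (lg (length T)))) b e (LCP_argmin T b e)))"
proof -
  \<comment> \<open>A word size of at most 40 may be too small to address the structure; a table of all answers then has
     at most $2^{80}$ entries.\<close>
  define C where "C = 2 ^ 80 + 150 * (4 / \<epsilon> + 2)"
  have C: "2 ^ 80 \<le> C" "150 * (4 / \<epsilon> + 2) \<le> C" using assms(1) by (auto simp: C_def)
  show ?thesis
  \<comment> \<open>One program has to serve all word sizes, so the distinction at 40 is made by the
    program itself when it tests whether 2 ^ 40 vanishes as a word.\<close>
  proof (rule exI[of _ "prog 40"], rule exI[of _ C], intro allI impI)
    fix T :: "'a list" and w :: nat
    assume a: "T \<noteq> [] \<and> log 2 (real (length T)) \<le> real w"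
    let ?l = "lg (length T)"
    have "real (length T) \<le> 2 powr real w" using a log_le_iff[of 2 "real (length T)" "real w"] by simp
    then have "real (length T) \<le> real (2 ^ w)" by (simp add: powr_realpow)
    then have n: "length T \<le> 2 ^ w" by (simp only: of_nat_le_iff)
    have l2: "2 \<le> ?l" by (rule lg_ge_2)
    have "1 \<le> log 2 ?l" using l2 by (subst le_log_iff) auto
    then have q1: "1 \<le> ?l / log 2 ?l" using log_2_le_self[of ?l] l2 by simp
    have s1: "1 \<le> real (bwt_runs T) * ?l powr (2 + \<epsilon>)"
    proof -
      have "1 \<le> real (bwt_runs T)" using bwt_runs_pos a by fastforce
      moreover have "1 \<le> ?l powr (2 + \<epsilon>)" using l2 assms by (intro ge_one_powr_ge_zero) auto
      ultimately show ?thesis using mult_mono[of 1 "real (bwt_runs T)" 1 "?l powr (2 + \<epsilon>)"] by simp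
    qed
    show "\<exists>D. set D \<subseteq> {..<2 ^ w} \<and> real (length D) \<le> C * (real (bwt_runs T) * ?l powr (2 + \<epsilon>)) \<and>
         (\<forall>b e. b < e \<and> e \<le> length T \<longrightarrow>
            answers_query w (prog 40) D (C * (?l / log 2 ?l)) b e (LCP_argmin T b e))"
    proof (cases "w \<le> 40")
      case True
      have z: "2 ^ 40 mod 2 ^ w = (0::nat)"
        using le_imp_power_dvd[OF True, of "2::nat"] by (simp only: mod_eq_0_iff_dvd)
      have "3 \<le> C * 1" using C by simp
      also have "\<dots> \<le> C * (?l / log 2 ?l)" using q1 C by (intro mult_left_mono) auto
      finally have time: "3 \<le> C * (?l / log 2 ?l)" .
      obtain D where D: "set D \<subseteq> {..<2 ^ w}" "length D = 2 ^ w * 2 ^ w"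
        "\<forall>b e. b < e \<and> e \<le> length T \<longrightarrow>
            answers_query w (prog 40) D (C * (?l / log 2 ?l)) b e (LCP_argmin T b e)"
        using table_answers[OF z n time] by blast
      have "(2::real) ^ w \<le> 2 ^ 40" using True by (intro power_increasing) auto
      then have "real (length D) \<le> 2 ^ 40 * 2 ^ 40" unfolding D(2) by (simp only: of_nat_mult of_nat_power of_nat_numeral) (intro mult_mono, auto)
      also have "\<dots> \<le> C * 1" using C(1) by simp
      also have "\<dots> \<le> C * (real (bwt_runs T) * ?l powr (2 + \<epsilon>))" using s1 C by (intro mult_left_mono) auto
      finally show ?thesis using D(1,3) by blast
    next
      case False
      then have w: "41 \<le> w" by simp
      have "(2::nat) ^ 40 < 2 ^ w" using False by (intro power_strict_increasing) auto
      then have z: "2 ^ 40 mod 2 ^ w \<noteq> (0::nat)" by simp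
      have "150 * (4 / \<epsilon> + 2) * (?l / log 2 ?l) \<le> C * (?l / log 2 ?l)"
        using C(2) q1 by (intro mult_right_mono) auto
      from structure_exists[OF assms conjunct1[OF a] n w z this]
      obtain D where D: "set D \<subseteq> {..<2 ^ w}"
         "real (length D) \<le> 55296 * (real (bwt_runs T) * ?l powr (2 + \<epsilon>))"
         "\<forall>b e. b < e \<and> e \<le> length T \<longrightarrow>
            answers_query w (prog 40) D (C * (?l / log 2 ?l)) b e (LCP_argmin T b e)" by blast
      have "55296 * (real (bwt_runs T) * ?l powr (2 + \<epsilon>)) \<le> C * (real (bwt_runs T) * ?l powr (2 + \<epsilon>))"
        using s1 C(1) by (intro mult_right_mono) auto
      then show ?thesis using D by (meson order_trans)
    qed
  qed
qed

end
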